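(* Let $T>0$, let $p\ge2$ be an even integer, let $F\in\mathbb{C}^{1,p}_b(\Lambda_T)$, and let $S\in V_p(\pi)$ for a sequence of partitions $\pi=(\pi_n)_{n\ge1}$ of $[0,T]$ with vanishing mesh size $|\pi_n|\to0$. Let $S^n$ be the piecewise constant approximation $S^n(t)=\sum_{[t_j,t_{j+1}]\in\pi_n}S(t_{j+1})\mathbf 1_{[t_j,t_{j+1})}(t)+S(T)\mathbf 1_{\{T\}}(t)$. Then for every $t\in[0,T]$ the limit $$\int_0^t\langle\nabla_\omega F(s,S_s),dS(s)\rangle:=\lim_{n\to\infty}\sum_{[t_j,t_{j+1}]\in\pi_n}\sum_{k=1}^{p-1}\frac1{k!}\nabla_\omega^kF(t_j,S^n_{t_j-})\bigl(S(t_{j+1}\wedge t)-S(t_j\wedge t)\bigr)^k$$ exists, and $$F(t,S_t)=F(0,S_0)+\int_0^t\mathcal DF(s,S_s)\,ds+\int_0^t\langle\nabla_\omega F(s,S_s),dS(s)\rangle+\frac1{p!}\int_0^t\nabla^p_\omega F(s,S_s)\,d[S]^p(s).$$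
   Context: Partitions: each $\pi_n=\{0=t^n_0<t^n_1<\dots<t^n_{N(\pi_n)}=T\}$ is finite; $[t_j,t_{j+1}]\in\pi_n$ means that $t_j<t_{j+1}$ are consecutive points of $\pi_n$; $|\pi_n|=\max|t_{j+1}-t_j|$. $\operatorname{osc}(S,\pi_n):=\max_{[t_j,t_{j+1}]\in\pi_n}\max_{r,s\in[t_j,t_{j+1}]}|S(s)-S(r)|$. A path $S\in C([0,T],\mathbb R)$ belongs to $V_p(\pi)$ if $\operatorname{osc}(S,\pi_n)\to0$ and the measures $\sum_{[t_j,t_{j+1}]\in\pi_n}\delta(\cdot-t_j)|S(t_{j+1})-S(t_j)|^p$ converge weakly to a measure $\mu$ on $[0,T]$ without atoms; then $[S]^p(t):=\mu([0,t])$. Functionals: $D([0,T],\mathbb R)$ is the space of càdlàg paths; $\omega_t(s)=\omega(s\wedge t)$ is the path stopped at $t$; for $t>0$, $\omega_{t-}(s)=\omega(s)$ if $s<t$ and $\omega_{t-}(s)=\lim_{r\uparrow t}\omega(r)$ if $s\ge t$, while $\omega_{0-}:=\omega_0$. $\Lambda_T=\{(t,\omega_t):(t,\omega)\in[0,T]\times D([0,T],\mathbb R)\}$ with metric $d_\infty((t,\omega),(t',\omega'))=\sup_{s\in[0,T]}|\omega(s\wedge t)-\omega'(s\wedge t')|+|t-t'|$. A non-anticipative functional is a map $F:\Lambda_T\to\mathbb R$; one writes $F(t,\omega)=F(t,\omega_t)$ for $\omega\in D([0,T],\mathbb R)$. (i) $F\in\mathbb C^{0,0}_l(\Lambda_T)$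 if for all $t\in[0,T]$ the map $F(t,\cdot):D([0,T],\mathbb R)\to\mathbb R$ is continuous (sup norm) and for all $(t,\omega)\in\Lambda_T$ and $\varepsilon>0$ there is $\delta>0$ such that $|F(t,\omega)-F(t',\omega')|<\varepsilon$ for all $(t',\omega')\in\Lambda_T$ with $t'<t$ and $d_\infty((t,\omega),(t',\omega'))<\delta$. (ii) $F\in\mathbb B(\Lambda_T)$ if for every $t_0\in[0,T)$ and $K>0$ there is $C_{K,t_0}>0$ such that $|F(t,\omega)|\le C_{K,t_0}$ for all $t\in[0,t_0]$ and all $\omega\in D([0,T],\mathbb R)$ with $\sup_{s\in[0,t]}|\omega(s)|\le K$. (iii) The horizontal derivative is $\mathcal DF(t,\omega)=\lim_{h\downarrow0}\frac{F(t+h,\omega_t)-F(t,\omega_t)}h$ (for $t<T$; at $t=T$ it is understood as $\lim_{t\uparrow T}\mathcal DF(t,\omega_t)$). (iv) The vertical derivative is $\nabla_\omega F(t,\omega)=\lim_{h\downarrow0}\frac{F(t,\omega_t+h\mathbf 1_{[t,T]})-F(t,\omega_t)}h$, and $\nabla^{k+1}_\omega F=\nabla_\omega\nabla^k_\omega F$. (v) For $p\in\mathbb N_0$, $F\in\mathbb C^{1,p}_b(\Lambda_T)$ if $F$ is horizontally differentiable and $p$ times vertically differentiable at every $(t,\omega)\in\Lambda_T$, and $F,\mathcal DF,\nabla^k_\omega F\in\mathbb C^{0,0}_l(\Lambda_T)\cap\mathbb B(\Lambda_T)$ for $k=1,\dots,p$. *)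

theory Defs
  imports "HOL-Analysis.Analysis"
begin

section \<open>Partitions and \<open>p\<close>-th variation\<close>

text \<open>A partition \<open>{0 = t\<^sub>0 < \<dots> < t\<^sub>N = T}\<close> is the list \<open>[t\<^sub>0, \<dots>, t\<^sub>N]\<close>. Its intervals are
  \<open>[P ! j, P ! Suc j]\<close> for \<open>j < N = num_intervals P\<close>.\<close>

definition is_partition :: "real \<Rightarrow> real list \<Rightarrow> bool" where
  "is_partition T P \<longleftrightarrow> P \<noteq> [] \<and> sorted_wrt (<) P \<and> hd P = 0 \<and> last P = T"

definition num_intervals :: "real list \<Rightarrow> nat" where
  "num_intervals P = length P - 1"

definition mesh :: "real list \<Rightarrow> real" where
  "mesh P = (MAX j\<in>{..<num_intervals P}. P ! Suc j - P ! j)"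

definition osc :: "(real \<Rightarrow> real) \<Rightarrow> real list \<Rightarrow> real" where
  "osc S P = (MAX j\<in>{..<num_intervals P}.
     SUP (r, s)\<in>{P ! j..P ! Suc j} \<times> {P ! j..P ! Suc j}. \<bar>S s - S r\<bar>)"

text \<open>The discrete measure \<open>\<Sum>\<^sub>j |S (t\<^sub>j\<^sub>+\<^sub>1) - S (t\<^sub>j)|\<^sup>p \<delta>\<^bsub>t\<^sub>j\<^esub>\<close> on the Borel sets of \<open>[0, T]\<close>: the push-forward
  under \<open>j \<mapsto> t\<^sub>j\<close> of the measure on the index set with these weights.\<close>

definition variation_measure ::
    "real \<Rightarrow> nat \<Rightarrow> real list \<Rightarrow> (real \<Rightarrow> real) \<Rightarrow> real measure" where
  "variation_measure T p P S =
     distr (point_measure {..<num_intervals P} (\<lambda>j. ennreal (\<bar>S (P ! Suc j) - S (P ! j)\<bar> ^ p)))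
       (restrict_space borel {0..T}) (\<lambda>j. P ! j)"

definition weakly_converges ::
    "real \<Rightarrow> (nat \<Rightarrow> real measure) \<Rightarrow> real measure \<Rightarrow> bool" where
  "weakly_converges T M \<mu> \<longleftrightarrow>
     (\<forall>f :: real \<Rightarrow> real. continuous_on {0..T} f \<longrightarrow>
        (\<lambda>n. integral\<^sup>L (M n) f) \<longlonglongrightarrow> integral\<^sup>L \<mu> f)"

text \<open>For a finite Borel measure on an interval, having no atoms means that points are null sets.\<close>

definition is_limit_variation ::
    "real \<Rightarrow> nat \<Rightarrow> (nat \<Rightarrow> real list) \<Rightarrow> (real \<Rightarrow> real) \<Rightarrow> real measure \<Rightarrow> bool" where
  "is_limit_variation T p \<pi> S \<mu> \<longleftrightarrow>
     finite_measure \<mu> \<and> sets \<mu> = sets (restrict_space borel {0..T}) \<and>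
     (\<forall>x\<in>{0..T}. emeasure \<mu> {x} = 0) \<and>
     weakly_converges T (\<lambda>n. variation_measure T p (\<pi> n) S) \<mu>"

definition V :: "real \<Rightarrow> nat \<Rightarrow> (nat \<Rightarrow> real list) \<Rightarrow> (real \<Rightarrow> real) set" where
  "V T p \<pi> = {S. continuous_on {0..T} S \<and> (\<lambda>n. osc S (\<pi> n)) \<longlonglongrightarrow> 0 \<and>
                 (\<exists>\<mu>. is_limit_variation T p \<pi> S \<mu>)}"

text \<open>The function \<open>[S]\<^sup>p\<close>, extended to the real line by \<open>0\<close> on the left of \<open>[0, T]\<close> and by its value
  at \<open>T\<close> on the right, so that \<open>interval_measure\<close> yields its Lebesgue-Stieltjes measure.
  Weak limits of finite measures are unique.\<close>

definition pvariation :: "real \<Rightarrow> nat \<Rightarrow> (nat \<Rightarrow> real list) \<Rightarrow> (real \<Rightarrow> real) \<Rightarrow> real \<Rightarrow> real" where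
  "pvariation T p \<pi> S t = measure (THE \<mu>. is_limit_variation T p \<pi> S \<mu>) ({0..t} \<inter> {0..T})"

section \<open>Paths and non-anticipative functionals\<close>

text \<open>Paths on \<open>[0, T]\<close> are represented by functions that are \<open>undefined\<close> outside \<open>[0, T]\<close>, so that
  equality of functions is equality of paths.\<close>

definition cadlag_paths :: "real \<Rightarrow> (real \<Rightarrow> real) set" where
  "cadlag_paths T = {\<omega> \<in> extensional {0..T}.
     (\<forall>t\<in>{0..<T}. (\<omega> \<longlongrightarrow> \<omega> t) (at_right t)) \<and>
     (\<forall>t\<in>{0<..T}. \<exists>l. (\<omega> \<longlongrightarrow> l) (at_left t))}"

definition stopped :: "real \<Rightarrow> real \<Rightarrow> (real \<Rightarrow> real) \<Rightarrow> real \<Rightarrow> real" where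
  "stopped T t \<omega> = (\<lambda>s\<in>{0..T}. \<omega> (min s t))"

text \<open>The path \<open>\<omega>\<^bsub>t-\<^esub>\<close>.\<close>

definition stopped_left :: "real \<Rightarrow> real \<Rightarrow> (real \<Rightarrow> real) \<Rightarrow> real \<Rightarrow> real" where
  "stopped_left T t \<omega> =
     (if t = 0 then stopped T 0 \<omega>
      else (\<lambda>s\<in>{0..T}. if s < t then \<omega> s else Lim (at_left t) \<omega>))"

definition Lambda :: "real \<Rightarrow> (real \<times> (real \<Rightarrow> real)) set" where
  "Lambda T = {(t, stopped T t \<omega>) | t \<omega>. t \<in> {0..T} \<and> \<omega> \<in> cadlag_paths T}"

definition d_sup :: "real \<Rightarrow> (real \<Rightarrow> real) \<Rightarrow> (real \<Rightarrow> real) \<Rightarrow> real" where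
  "d_sup T \<omega> \<omega>' = (SUP s\<in>{0..T}. \<bar>\<omega> s - \<omega>' s\<bar>)"

definition d_infty ::
    "real \<Rightarrow> real \<times> (real \<Rightarrow> real) \<Rightarrow> real \<times> (real \<Rightarrow> real) \<Rightarrow> real" where
  "d_infty T = (\<lambda>(t, \<omega>) (t', \<omega>').
     (SUP s\<in>{0..T}. \<bar>\<omega> (min s t) - \<omega>' (min s t')\<bar>) + \<bar>t - t'\<bar>)"

text \<open>A non-anticipative functional is a map on \<open>Lambda T\<close>; values elsewhere are never used below.
  For an arbitrary path \<open>\<omega>\<close>, \<open>F(t, \<omega>)\<close> means \<open>F (t, stopped T t \<omega>)\<close>.\<close>

type_synonym functional = "real \<times> (real \<Rightarrow> real) \<Rightarrow> real"

definition C00_left :: "real \<Rightarrow> functional set" where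
  "C00_left T = {F.
     (\<forall>t\<in>{0..T}. \<forall>\<omega>\<in>cadlag_paths T. \<forall>\<epsilon>>0. \<exists>\<delta>>0. \<forall>\<omega>'\<in>cadlag_paths T.
        d_sup T \<omega> \<omega>' < \<delta> \<longrightarrow> \<bar>F (t, stopped T t \<omega>) - F (t, stopped T t \<omega>')\<bar> < \<epsilon>) \<and>
     (\<forall>(t, \<omega>)\<in>Lambda T. \<forall>\<epsilon>>0. \<exists>\<delta>>0. \<forall>(t', \<omega>')\<in>Lambda T.
        t' < t \<and> d_infty T (t, \<omega>) (t', \<omega>') < \<delta> \<longrightarrow> \<bar>F (t, \<omega>) - F (t', \<omega>')\<bar> < \<epsilon>)}"

definition bounded_functionals :: "real \<Rightarrow> functional set" where
  "bounded_functionals T = {F.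
     \<forall>t\<^sub>0\<in>{0..<T}. \<forall>K>0. \<exists>C>0. \<forall>t\<in>{0..t\<^sub>0}. \<forall>\<omega>\<in>cadlag_paths T.
       (SUP s\<in>{0..t}. \<bar>\<omega> s\<bar>) \<le> K \<longrightarrow> \<bar>F (t, stopped T t \<omega>)\<bar> \<le> C}"

section \<open>Horizontal and vertical derivatives\<close>

definition hquotient :: "real \<Rightarrow> functional \<Rightarrow> real \<Rightarrow> (real \<Rightarrow> real) \<Rightarrow> real \<Rightarrow> real" where
  "hquotient T F t \<omega> h = (F (t + h, stopped T t \<omega>) - F (t, stopped T t \<omega>)) / h"

text \<open>The value at \<open>t = T\<close> is the limit of the values at \<open>(s, \<omega>\<^sub>s)\<close> as \<open>s\<close> increases to \<open>T\<close>; its existence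
  is part of horizontal differentiability.\<close>

definition hderiv :: "real \<Rightarrow> functional \<Rightarrow> functional" where
  "hderiv T F = (\<lambda>(t, \<omega>).
     if t < T then Lim (at_right 0) (hquotient T F t \<omega>)
     else Lim (at_left T) (\<lambda>s. Lim (at_right 0) (hquotient T F s (stopped T s \<omega>))))"

definition horizontally_differentiable :: "real \<Rightarrow> functional \<Rightarrow> bool" where
  "horizontally_differentiable T F \<longleftrightarrow>
     (\<forall>(t, \<omega>)\<in>Lambda T.
        if t < T then \<exists>l. (hquotient T F t \<omega> \<longlongrightarrow> l) (at_right 0)
        else \<exists>l. ((\<lambda>s. hderiv T F (s, stopped T s \<omega>)) \<longlongrightarrow> l) (at_left T))"

definition bumped :: "real \<Rightarrow> real \<Rightarrow> real \<Rightarrow> (real \<Rightarrow> real) \<Rightarrow> real \<Rightarrow> real" where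
  "bumped T t h \<omega> = (\<lambda>s\<in>{0..T}. stopped T t \<omega> s + h * indicator {t..T} s)"

definition vquotient :: "real \<Rightarrow> functional \<Rightarrow> real \<Rightarrow> (real \<Rightarrow> real) \<Rightarrow> real \<Rightarrow> real" where
  "vquotient T F t \<omega> h = (F (t, bumped T t h \<omega>) - F (t, stopped T t \<omega>)) / h"

definition vderiv :: "real \<Rightarrow> functional \<Rightarrow> functional" where
  "vderiv T F = (\<lambda>(t, \<omega>). Lim (at_right 0) (vquotient T F t \<omega>))"

definition vertically_differentiable :: "real \<Rightarrow> functional \<Rightarrow> bool" where
  "vertically_differentiable T F \<longleftrightarrow>
     (\<forall>(t, \<omega>)\<in>Lambda T. \<exists>l. (vquotient T F t \<omega> \<longlongrightarrow> l) (at_right 0))"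

definition C1p_b :: "real \<Rightarrow> nat \<Rightarrow> functional set" where
  "C1p_b T p = {F.
     horizontally_differentiable T F \<and>
     (\<forall>k<p. vertically_differentiable T ((vderiv T ^^ k) F)) \<and>
     F \<in> C00_left T \<inter> bounded_functionals T \<and>
     hderiv T F \<in> C00_left T \<inter> bounded_functionals T \<and>
     (\<forall>k\<in>{1..p}. (vderiv T ^^ k) F \<in> C00_left T \<inter> bounded_functionals T)}"

section \<open>The pathwise integral\<close>

definition pc_approx :: "real \<Rightarrow> real list \<Rightarrow> (real \<Rightarrow> real) \<Rightarrow> real \<Rightarrow> real" where
  "pc_approx T P S s =
     (\<Sum>j<num_intervals P. S (P ! Suc j) * indicator {P ! j..<P ! Suc j} s) + S T * indicator {T} s"

definition integral_sum ::
    "real \<Rightarrow> nat \<Rightarrow> functional \<Rightarrow> (real \<Rightarrow> real) \<Rightarrow> real list \<Rightarrow> real \<Rightarrow> real" where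
  "integral_sum T p F S P t =
     (\<Sum>j<num_intervals P. \<Sum>k=1..p-1.
        1 / fact k * (vderiv T ^^ k) F (P ! j, stopped_left T (P ! j) (pc_approx T P S))
        * (S (min (P ! Suc j) t) - S (min (P ! j) t)) ^ k)"

definition pathwise_integral ::
    "real \<Rightarrow> nat \<Rightarrow> (nat \<Rightarrow> real list) \<Rightarrow> functional \<Rightarrow> (real \<Rightarrow> real) \<Rightarrow> real \<Rightarrow> real" where
  "pathwise_integral T p \<pi> F S t = lim (\<lambda>n. integral_sum T p F S (\<pi> n) t)"

end

theory Submission
  imports Defs "HOL-Probability.Distribution_Functions"
begin

text \<open>The piecewise constant approximations, stopped just before a partition point, are built from one
  another by a vertical jump at \<open>t\<^sub>j\<close> followed by a horizontal extension to \<open>t\<^sub>j\<^sub>+\<^sub>1\<close>. Along them \<open>F\<close>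
  telescopes into horizontal increments, which are integrals of the horizontal derivative, and vertical
  increments, which are expanded by Taylor's formula up to order \<open>p\<close>. The horizontal part converges by
  dominated convergence. The \<open>p\<close>-th order terms are integrals against the discrete variation measures of
  integrands that are only left-continuous, jointly in time and path, in the limit; this suffices
  because the limit measure has no atoms and left neighbourhoods of all points cover all but
  countably many points. Boundedness near the terminal time, where membership in
  \<open>bounded_functionals T\<close> gives nothing, comes from left-continuity.\<close>

section \<open>Left-continuous integrands under weak convergence\<close>

text \<open>The existence of the pathwise integral is never estimated directly: the telescoped
  identity is solved for the terms of order 1 to p-1, and their total converges because everything
  else in the identity does. No convergence is claimed for a single order k. Two obstacles shape the
  rest. First, the continuity assumed of a functional has a modulus that depends on the time and on
  the path, so no estimate is uniform over the partition points. What is uniform is the distance of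
  the approximating paths from \<open>S\<close>: a fixed multiple of \<open>osc S (\<pi> n)\<close>.
  Hence every fact about functionals is stated on sup-norm balls around the stopped path
  (\<open>tube\<close>), and limits are taken pointwise. In the p-th order terms the integrand even
  varies with n, so weak convergence does not apply to it as it stands. Second, both derivatives are
  limits of right quotients only. Vertically, continuity in the size of the jump turns them into
  genuine derivatives. Horizontally, the derivative may be discontinuous in time, and only its
  integral is recovered. Evenness of p enters where a p-th power of an increment is identified with
  that of its absolute value.\<close>

lemma borel_measurable_left_continuous:
  fixes f :: "real \<Rightarrow> real"
  assumes "\<And>u. u \<in> {0<..t} \<Longrightarrow> (f \<longlongrightarrow> f u) (at u within {0..<u})"
  shows "f \<in> borel_measurable (restrict_space borel {0..t})"
proof -
  \<comment> \<open>For u > 0 this is the largest multiple of 1/(m+1) strictly below u; ceiling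
    minus one, not floor, because the limit at u is taken within \<open>{0..<u}\<close>. Since
    \<open>f (q m u)\<close> depends on u through an integer only, it is measurable for any f. The
    maximum with 0 fixes the point u = 0, where left-continuity says nothing.\<close>
  define q where "q m u = max 0 ((of_int \<lceil>real (Suc m) * u\<rceil> - 1) / real (Suc m))" for m u
  have meas: "(\<lambda>u. f (q m u)) \<in> borel_measurable borel" for m
  proof -
    have "(\<lambda>u::real. \<lceil>real (Suc m) * u\<rceil>) \<in> borel \<rightarrow>\<^sub>M count_space UNIV"
      by measurable
    then have "(\<lambda>u. (\<lambda>k::int. f (max 0 ((of_int k - 1) / real (Suc m)))) \<lceil>real (Suc m) * u\<rceil>)
        \<in> borel_measurable borel"
      by (rule measurable_compose) simp
    then show ?thesis by (simp add: q_def)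
  qed
  have lim: "(\<lambda>m. f (q m u)) \<longlonglongrightarrow> f u" if u: "u \<in> {0..t}" for u
  proof (cases "u = 0")
    case True
    then have "q m u = 0" for m by (simp add: q_def)
    then show ?thesis using True by simp
  next
    case False
    then have u0: "u > 0" using u by simp
    have lt: "q m u < u" for m
    proof -
      have "of_int \<lceil>real (Suc m) * u\<rceil> - 1 < real (Suc m) * u" by linarith
      then show ?thesis using u0 by (simp add: q_def divide_less_eq mult.commute)
    qed
    have ge: "u - 1 / real (Suc m) \<le> q m u" for m
    proof -
      have "real (Suc m) * u - 1 \<le> of_int \<lceil>real (Suc m) * u\<rceil> - 1" by linarith
      then have "(real (Suc m) * u - 1) / real (Suc m) \<le> (of_int \<lceil>real (Suc m) * u\<rceil> - 1) / real (Suc m)"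
        by (rule divide_right_mono) simp
      moreover have "(real (Suc m) * u - 1) / real (Suc m) = u - 1 / real (Suc m)"
        by (simp add: diff_divide_distrib del: of_nat_Suc)
      ultimately show ?thesis unfolding q_def by linarith
    qed
    have "(\<lambda>m. q m u) \<longlonglongrightarrow> u"
    proof (rule real_tendsto_sandwich)
      show "(\<lambda>m. u - 1 / real (Suc m)) \<longlonglongrightarrow> u"
        using tendsto_diff[OF tendsto_const[of u] LIMSEQ_inverse_real_of_nat]
        by (simp add: inverse_eq_divide)
      show "(\<lambda>m. u) \<longlonglongrightarrow> u" by simp
    qed (use ge less_imp_le[OF lt] in auto)
    then have "filterlim (\<lambda>m. q m u) (at u within {0..<u}) sequentially"
      unfolding filterlim_at using lt
      by (auto simp: less_imp_neq intro!: always_eventually) (simp add: q_def)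
    then show ?thesis
      using assms[of u] u u0 by (auto intro: filterlim_compose)
  qed
  show ?thesis
    by (rule borel_measurable_LIMSEQ_real[where u = "\<lambda>m u. f (q m u)"])
      (use lim meas in \<open>auto simp: space_restrict_space intro!: measurable_restrict_space1\<close>)
qed

section \<open>Continuous test functions and convergence of discrete masses on intervals\<close>

definition left_ramp :: "real \<Rightarrow> real \<Rightarrow> real \<Rightarrow> real" where
  "left_ramp a b u = max 0 (min 1 ((b - u) / (b - a)))"

lemma left_ramp_bounds:
  assumes "a < b"
  shows "indicator {..a} u \<le> left_ramp a b u" "left_ramp a b u \<le> indicator {..<b} u"
    "0 \<le> left_ramp a b u" "left_ramp a b u \<le> 1"
  using assms by (auto simp: left_ramp_def indicator_def divide_le_0_iff le_divide_eq)

lemma continuous_on_left_ramp: "continuous_on A (left_ramp a b)"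
  unfolding left_ramp_def by (cases "a = b") (auto intro!: continuous_intros)

text \<open>Abstract form of the discrete variation measures: mass \<open>w n j\<close> at the node
  \<open>x n j\<close>, with the limit moved to the whole real line, where distribution functions
  are available. Ramps are the only test functions used, since their integrals already squeeze the
  distribution function.\<close>

locale weighted_nodes_limit = finite_borel_measure \<nu> for \<nu> :: "real measure" +
  fixes N :: "nat \<Rightarrow> nat" and x w :: "nat \<Rightarrow> nat \<Rightarrow> real"
  assumes atomless: "\<And>a. measure \<nu> {a} = 0"
    and weight_nonneg: "\<And>n j. 0 \<le> w n j"
    and weak_limit: "\<And>a b. a < b \<Longrightarrow>
      (\<lambda>n. \<Sum>j<N n. w n j * left_ramp a b (x n j)) \<longlonglongrightarrow> (\<integral>u. left_ramp a b u \<partial>\<nu>)"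
begin

lemma space_eq_UNIV [simp]: "space \<nu> = UNIV"
  using sets_eq_imp_space_eq[OF M_is_borel] by simp

lemma integrable_left_ramp: "a < b \<Longrightarrow> integrable \<nu> (left_ramp a b)"
  by (rule integrable_const_bound[where B = 1])
    (auto simp: left_ramp_bounds M_is_borel
      intro!: borel_measurable_continuous_onI continuous_on_left_ramp
      simp: measurable_cong_sets[OF M_is_borel refl])

lemma cdf_le_integral_left_ramp: "a < b \<Longrightarrow> cdf \<nu> a \<le> (\<integral>u. left_ramp a b u \<partial>\<nu>)"
proof -
  assume "a < b"
  then have "(\<integral>u. indicator {..a} u \<partial>\<nu>) \<le> (\<integral>u. left_ramp a b u \<partial>\<nu>)"
    by (intro integral_mono integrable_left_ramp)
      (auto simp: left_ramp_bounds M_is_borel less_top[symmetric])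
  then show ?thesis by (simp add: cdf_def)
qed

lemma integral_left_ramp_le_cdf: "a < b \<Longrightarrow> (\<integral>u. left_ramp a b u \<partial>\<nu>) \<le> cdf \<nu> b"
proof -
  assume "a < b"
  then have "(\<integral>u. left_ramp a b u \<partial>\<nu>) \<le> (\<integral>u. indicator {..b} u \<partial>\<nu>)"
    by (intro integral_mono integrable_left_ramp integrable_real_indicator
        order_trans[OF left_ramp_bounds(2)])
      (auto simp: M_is_borel less_top[symmetric] split: split_indicator)
  then show ?thesis by (simp add: cdf_def)
qed

text \<open>The indicator of the half-line lies between the ramps falling on [b-h, b] and on
  [b, b+h]. Their integrals lie between the values of the distribution function at b-h and b+h,
  which are close to each other because absence of atoms makes it continuous.\<close>

lemma weight_below_tendsto_cdf: "(\<lambda>n. \<Sum>j<N n. w n j * indicator {..<b} (x n j)) \<longlonglongrightarrow> cdf \<nu> b"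
proof (rule tendstoI)
  fix e :: real assume e: "e > 0"
  have "isCont (cdf \<nu>) b" using atomless isCont_cdf by blast
  then obtain d where d: "d > 0" "\<And>y. \<bar>y - b\<bar> < d \<Longrightarrow> \<bar>cdf \<nu> y - cdf \<nu> b\<bar> < e / 2"
    using e unfolding continuous_at_eps_delta dist_real_def
    by (metis half_gt_zero)
  define h where "h = d / 2"
  have h: "h > 0" "\<bar>cdf \<nu> (b + h) - cdf \<nu> b\<bar> < e / 2" "\<bar>cdf \<nu> (b - h) - cdf \<nu> b\<bar> < e / 2"
    using d by (auto simp: h_def)
  have "eventually (\<lambda>n. dist (\<Sum>j<N n. w n j * left_ramp b (b + h) (x n j))
      (\<integral>u. left_ramp b (b + h) u \<partial>\<nu>) < e / 2) sequentially"
    using h e by (intro tendstoD[OF weak_limit]) auto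
  moreover have "eventually (\<lambda>n. dist (\<Sum>j<N n. w n j * left_ramp (b - h) b (x n j))
      (\<integral>u. left_ramp (b - h) b u \<partial>\<nu>) < e / 2) sequentially"
    using h e by (intro tendstoD[OF weak_limit]) auto
  ultimately show "eventually (\<lambda>n. dist (\<Sum>j<N n. w n j * indicator {..<b} (x n j)) (cdf \<nu> b) < e) sequentially"
  proof eventually_elim
    case (elim n)
    have "indicator {..<b} u \<le> left_ramp b (b + h) u" for u
      using left_ramp_bounds(1)[of b "b + h" u] left_ramp_bounds(3)[of b "b + h" u] h
      by (auto simp: indicator_def split: if_splits)
    then have "(\<Sum>j<N n. w n j * indicator {..<b} (x n j)) \<le> (\<Sum>j<N n. w n j * left_ramp b (b + h) (x n j))"
      by (intro sum_mono mult_left_mono weight_nonneg)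
    moreover have "(\<Sum>j<N n. w n j * left_ramp (b - h) b (x n j)) \<le> (\<Sum>j<N n. w n j * indicator {..<b} (x n j))"
      using h by (intro sum_mono mult_left_mono weight_nonneg left_ramp_bounds) auto
    moreover have "(\<integral>u. left_ramp b (b + h) u \<partial>\<nu>) \<le> cdf \<nu> (b + h)"
      using h by (intro integral_left_ramp_le_cdf) auto
    moreover have "cdf \<nu> (b - h) \<le> (\<integral>u. left_ramp (b - h) b u \<partial>\<nu>)"
      using h by (intro cdf_le_integral_left_ramp) auto
    ultimately show ?case using elim h unfolding dist_real_def by linarith
  qed
qed

lemma measure_Ico: "a \<le> b \<Longrightarrow> measure \<nu> {a..<b} = cdf \<nu> b - cdf \<nu> a"
proof -
  assume ab: "a \<le> b"
  have lt: "measure \<nu> {..<c} = cdf \<nu> c" for c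
  proof -
    have "measure \<nu> ({..<c} \<union> {c}) = measure \<nu> {..<c} + measure \<nu> {c}"
      by (intro finite_measure_Union) auto
    moreover have "{..<c} \<union> {c} = {..c}" by auto
    ultimately show ?thesis by (simp add: atomless cdf_def)
  qed
  have "measure \<nu> ({..<b} - {..<a}) = measure \<nu> {..<b} - measure \<nu> {..<a}"
    using ab by (intro finite_measure_Diff) auto
  moreover have "{..<b} - {..<a} = {a..<b}" by auto
  ultimately show ?thesis by (simp add: lt)
qed

lemma weight_Ico_tendsto:
  assumes "a \<le> b"
  shows "(\<lambda>n. \<Sum>j<N n. w n j * indicator {a..<b} (x n j)) \<longlonglongrightarrow> measure \<nu> {a..<b}"
proof -
  have ind: "indicator {a..<b} u = indicator {..<b} u - (indicator {..<a} u :: real)" for u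
    using assms by (auto simp: indicator_def)
  have "(\<Sum>j<N n. w n j * indicator {a..<b} (x n j)) =
     (\<Sum>j<N n. w n j * indicator {..<b} (x n j)) - (\<Sum>j<N n. w n j * indicator {..<a} (x n j))" for n
    unfolding ind by (simp only: right_diff_distrib sum_subtractf)
  then show ?thesis
    unfolding measure_Ico[OF assms]
    by (simp only: tendsto_diff[OF weight_below_tendsto_cdf weight_below_tendsto_cdf])
qed

text \<open>On [0, t) only finitely many grid cells occur, so g is a finite combination of
  indicators of half-open intervals, the last one cut off at t. This holds for any values h, which
  is why the lemma also serves for error envelopes.\<close>

lemma weighted_step_function_tendsto:
  fixes h :: "int \<Rightarrow> real" and t :: real
  assumes "m > 0"
  defines "g \<equiv> \<lambda>u. h \<lfloor>real m * u\<rfloor> * indicator {0..<t} u"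
  shows "(\<lambda>n. \<Sum>j<N n. w n j * g (x n j)) \<longlonglongrightarrow> (\<integral>u. g u \<partial>\<nu>)" "integrable \<nu> g"
proof -
  define K where "K = {0..\<lfloor>real m * t\<rfloor>}"
  define I where "I k = {of_int k / real m ..< min (of_int (k + 1) / real m) t}" for k :: int
  have I_iff: "u \<in> I k \<longleftrightarrow> \<lfloor>real m * u\<rfloor> = k \<and> u < t" for u k
    using assms(1) unfolding I_def floor_eq_iff by (auto simp: field_simps)
  have g_eq: "g u = (\<Sum>k\<in>K. h k * indicator (I k) u)" for u
  proof (cases "u \<in> {0..<t}")
    case True
    define k0 where "k0 = \<lfloor>real m * u\<rfloor>"
    have "k0 \<in> K"
      using True assms(1) by (auto simp: K_def k0_def intro!: floor_mono)
    have "(\<Sum>k\<in>K. h k * indicator (I k) u) = (\<Sum>k\<in>K. if k = k0 then h k else 0)"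
      using True by (intro sum.cong) (auto simp: indicator_def I_iff k0_def)
    also have "\<dots> = h k0" using \<open>k0 \<in> K\<close> by (simp add: K_def)
    finally show ?thesis using True by (simp add: g_def k0_def)
  next
    case False
    have "u \<notin> I k" if "k \<in> K" for k
      using that False assms(1) by (auto simp: I_iff K_def zero_le_mult_iff)
    then have "(\<Sum>k\<in>K. h k * indicator (I k) u) = 0" by (intro sum.neutral) auto
    then show ?thesis using False by (simp add: g_def)
  qed
  have int: "integrable \<nu> (\<lambda>u. h k * indicator (I k) u)" for k
    by (auto simp: I_def less_top[symmetric] intro!: integrable_real_indicator)
  show "integrable \<nu> g"
    unfolding g_eq using int by (auto intro!: Bochner_Integration.integrable_sum)
  have sum_eq: "(\<Sum>j<N n. w n j * g (x n j)) =
      (\<Sum>k\<in>K. h k * (\<Sum>j<N n. w n j * indicator (I k) (x n j)))" for n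
    unfolding g_eq sum_distrib_left by (subst sum.swap) (simp add: ac_simps)
  have int_eq: "(\<integral>u. g u \<partial>\<nu>) = (\<Sum>k\<in>K. h k * measure \<nu> (I k))"
    unfolding g_eq using int by (subst Bochner_Integration.integral_sum) auto
  show "(\<lambda>n. \<Sum>j<N n. w n j * g (x n j)) \<longlonglongrightarrow> (\<integral>u. g u \<partial>\<nu>)"
    unfolding sum_eq int_eq
  proof (intro tendsto_sum tendsto_mult tendsto_const)
    fix k assume "k \<in> K"
    then have "k \<le> \<lfloor>real m * t\<rfloor>" by (simp add: K_def)
    then have "of_int k \<le> real m * t" by (simp add: le_floor_iff)
    then have "of_int k / real m \<le> min (of_int (k + 1) / real m) t"
      using assms(1) by (auto simp: field_simps)
    then show "(\<lambda>n. \<Sum>j<N n. w n j * indicator (I k) (x n j)) \<longlonglongrightarrow> measure \<nu> (I k)"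
      unfolding I_def by (rule weight_Ico_tendsto)
  qed
qed

text \<open>On a fine grid, the step function through the values of \<open>f\<close> at the grid points is \<open>\<epsilon>\<close>-close to \<open>f\<close>
  and to \<open>r\<close> on every cell that lies inside one of the left neighbourhoods of \<open>f_left\<close> and \<open>r_left\<close>
  (\<open>Good\<close>). The points \<open>X\<close> in no such neighbourhood are isolated from the left, hence countable and
  null, so the measure of the other cells tends to 0.\<close>

lemma weighted_sum_tendsto:
  fixes f :: "real \<Rightarrow> real" and r :: "nat \<Rightarrow> nat \<Rightarrow> real" and t C :: real
  assumes nodes: "\<And>n j. j < N n \<Longrightarrow> 0 \<le> x n j"
    and f_left: "\<And>s e. s \<in> {0<..t} \<Longrightarrow> e > 0 \<Longrightarrow>
      \<exists>d>0. \<forall>u. 0 \<le> u \<and> s - d < u \<and> u < s \<longrightarrow> \<bar>f u - f s\<bar> < e"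
    and r_left: "\<And>s e. s \<in> {0<..t} \<Longrightarrow> e > 0 \<Longrightarrow>
      \<exists>d>0. \<exists>n0. \<forall>n\<ge>n0. \<forall>j<N n. s - d < x n j \<and> x n j < s \<longrightarrow> \<bar>r n j - f s\<bar> < e"
    and f_bound: "\<And>u. u \<in> {0..<t} \<Longrightarrow> \<bar>f u\<bar> \<le> C"
    and r_bound: "\<exists>n0. \<forall>n\<ge>n0. \<forall>j<N n. x n j < t \<longrightarrow> \<bar>r n j\<bar> \<le> C"
    and f_meas: "(\<lambda>u. f u * indicator {0..<t} u) \<in> borel_measurable borel"
  shows "(\<lambda>n. \<Sum>j<N n. w n j * (r n j * indicator {0..<t} (x n j)))
    \<longlonglongrightarrow> (\<integral>u. f u * indicator {0..<t} u \<partial>\<nu>)" (is "?A \<longlonglongrightarrow> ?I")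
proof (rule tendstoI)
  fix e :: real assume e: "e > 0"
  define L where "L = measure \<nu> {0..<t}"
  \<comment> \<open>An error \<epsilon> on all of [0, t) then costs at most
    \<open>\<epsilon> * L\<close>, which is below e/3; the +1 covers L = 0.\<close>
  define \<epsilon> where "\<epsilon> = e / (3 * (L + 1))"
  have L: "L \<ge> 0" by (simp add: L_def)
  then have eps: "\<epsilon> > 0" using e by (simp add: \<epsilon>_def)
  have epsL: "\<epsilon> * L < e / 3" using e L by (simp add: \<epsilon>_def field_simps)
  have "\<exists>d n0. d > 0 \<and> (\<forall>u. 0 \<le> u \<and> s - d < u \<and> u < s \<longrightarrow> \<bar>f u - f s\<bar> < \<epsilon> / 2) \<and>
      (\<forall>n\<ge>n0. \<forall>j<N n. s - d < x n j \<and> x n j < s \<longrightarrow> \<bar>r n j - f s\<bar> < \<epsilon> / 2)"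
    if s: "s \<in> {0<..t}" for s
  proof -
    obtain d1 where d1: "d1 > 0" "\<And>u. 0 \<le> u \<Longrightarrow> s - d1 < u \<Longrightarrow> u < s \<Longrightarrow> \<bar>f u - f s\<bar> < \<epsilon> / 2"
      using f_left[OF s, of "\<epsilon> / 2"] eps by auto
    obtain d2 n0 where d2: "d2 > 0" "\<And>n j. n \<ge> n0 \<Longrightarrow> j < N n \<Longrightarrow> s - d2 < x n j \<Longrightarrow> x n j < s \<Longrightarrow> \<bar>r n j - f s\<bar> < \<epsilon> / 2"
      using r_left[OF s, of "\<epsilon> / 2"] eps by auto
    show ?thesis
      by (rule exI[of _ "min d1 d2"], rule exI[of _ n0]) (use d1 d2 in auto)
  qed
  then obtain d n0 where d: "\<And>s. s \<in> {0<..t} \<Longrightarrow> d s > 0"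
      and fd: "\<And>s u. s \<in> {0<..t} \<Longrightarrow> 0 \<le> u \<Longrightarrow> s - d s < u \<Longrightarrow> u < s \<Longrightarrow> \<bar>f u - f s\<bar> < \<epsilon> / 2"
      and rd: "\<And>s n j. s \<in> {0<..t} \<Longrightarrow> n \<ge> n0 s \<Longrightarrow> j < N n \<Longrightarrow> s - d s < x n j \<Longrightarrow> x n j < s \<Longrightarrow> \<bar>r n j - f s\<bar> < \<epsilon> / 2"
    by metis
  define X where "X = {u \<in> {0..<t}. \<forall>s\<in>{0<..t}. \<not> (s - d s < u \<and> u < s)}"
  have "countable X"
  proof -
    \<comment> \<open>Each nonzero u in X receives a rational in its own left neighbourhood. If u <
      v shared one, it would lie above \<open>v - d v\<close> and below u, placing u in the left
      neighbourhood of v, contrary to u in X. The point 0 has no left neighbourhood and is added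
      separately.\<close>
    have "\<exists>q. q \<in> \<rat> \<and> u - d u < q \<and> q < u" if "u \<in> X - {0}" for u
    proof -
      have "d u > 0" using that by (intro d) (auto simp: X_def)
      then show ?thesis using Rats_dense_in_real[of "u - d u" u] by auto
    qed
    then obtain q where q: "\<And>u. u \<in> X - {0} \<Longrightarrow> q u \<in> \<rat> \<and> u - d u < q u \<and> q u < u" by metis
    have less: "q u \<noteq> q v" if "u \<in> X - {0}" "v \<in> X - {0}" "u < v" for u v
    proof
      assume "q u = q v"
      then have "v - d v < u" using q[OF that(1)] q[OF that(2)] by linarith
      then show False using that unfolding X_def by force
    qed
    have "inj_on q (X - {0})" by (rule linorder_inj_onI) (use less in auto)
    moreover have "countable (q ` (X - {0}))"
      by (rule countable_subset[OF _ countable_rat]) (use q in auto)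
    ultimately have "countable (X - {0})" by (simp add: countable_image_inj_eq)
    then show ?thesis by simp
  qed
  moreover have "AE u in \<nu>. u \<noteq> a" for a
    by (rule AE_I[of _ _ "{a}"]) (auto simp: emeasure_eq_measure atomless)
  ultimately have AE_X: "AE u in \<nu>. \<forall>a\<in>X. u \<noteq> a"
    by (subst AE_ball_countable) auto
  \<comment> \<open>The second clause ranges over all n \<ge> m, so that goodness depends on m
    alone; once m exceeds \<open>n0 s\<close>, the threshold belonging to the neighbourhood of s is
    met.\<close>
  define Good where "Good m k \<longleftrightarrow>
      (\<forall>u. 0 \<le> u \<and> u < t \<and> \<lfloor>real m * u\<rfloor> = k \<longrightarrow> \<bar>f u - f (of_int k / real m)\<bar> \<le> \<epsilon>) \<and>
      (\<forall>n\<ge>m. \<forall>j<N n. x n j < t \<and> \<lfloor>real m * x n j\<rfloor> = k \<longrightarrow> \<bar>r n j - f (of_int k / real m)\<bar> \<le> \<epsilon>)"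
    for m :: nat and k :: int
  define fm where "fm m u = f (of_int \<lfloor>real m * u\<rfloor> / real m) * indicator {0..<t} u" for m :: nat and u :: real
  \<comment> \<open>Error envelope: \<epsilon> on good cells, the trivial bound for a difference of
    two values elsewhere. It is a step function on the same grid, so one estimate of its integral
    controls both the integral of the error and, for large n, the discrete error sums.\<close>
  define gm where "gm m u = (if Good m \<lfloor>real m * u\<rfloor> then \<epsilon> else 2 * \<bar>C\<bar>) * indicator {0..<t} u" for m :: nat and u :: real
  have gm_tendsto: "(\<lambda>m. gm m u) \<longlonglongrightarrow> \<epsilon> * indicator {0..<t} u" if "u \<notin> X" for u
  proof (cases "u \<in> {0..<t}")
    case False
    then show ?thesis by (simp add: gm_def)
  next
    case True
    then have "\<exists>s\<in>{0<..t}. s - d s < u \<and> u < s"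
      using that by (simp add: X_def)
    then obtain s where s: "s \<in> {0<..t}" "s - d s < u" "u < s" by blast
    \<comment> \<open>A grid finer than the distances from u to both ends of (s - d s, s) puts the
      whole cell of u inside that neighbourhood.\<close>
    have "eventually (\<lambda>m. 1 / real m < min (s - u) (u - (s - d s))) sequentially"
      using s by (intro order_tendstoD(2)[OF lim_1_over_n]) auto
    moreover have "eventually (\<lambda>m. m \<ge> max 1 (n0 s)) sequentially"
      by (rule eventually_ge_at_top)
    ultimately have "eventually (\<lambda>m. gm m u = \<epsilon> * indicator {0..<t} u) sequentially"
    proof eventually_elim
      case (elim m)
      define k where "k = \<lfloor>real m * u\<rfloor>"
      have m: "m > 0" "m \<ge> n0 s" using elim by auto
      have near: "s - d s < v \<and> v < s" if "\<lfloor>real m * v\<rfloor> = k" for v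
      proof -
        have "\<bar>real m * v - real m * u\<bar> < 1" using that unfolding k_def by linarith
        then have "real m * \<bar>v - u\<bar> < 1"
          by (simp add: abs_mult flip: right_diff_distrib)
        then have "\<bar>v - u\<bar> < 1 / real m" using m by (simp add: field_simps)
        then show ?thesis using elim by auto
      qed
      have k0: "0 \<le> k" using True by (simp add: k_def)
      have "\<lfloor>real m * (of_int k / real m)\<rfloor> = k" using m by simp
      then have fk: "\<bar>f (of_int k / real m) - f s\<bar> < \<epsilon> / 2"
        using near k0 s by (intro fd) auto
      have "Good m k"
        unfolding Good_def
      proof (intro conjI allI impI)
        fix v assume v: "0 \<le> v \<and> v < t \<and> \<lfloor>real m * v\<rfloor> = k"
        then have "\<bar>f v - f s\<bar> < \<epsilon> / 2" using near s by (intro fd) auto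
        then show "\<bar>f v - f (of_int k / real m)\<bar> \<le> \<epsilon>" using fk by linarith
      next
        fix n j assume n: "m \<le> n" "j < N n" and v: "x n j < t \<and> \<lfloor>real m * x n j\<rfloor> = k"
        then have "\<bar>r n j - f s\<bar> < \<epsilon> / 2" using near s m by (intro rd) auto
        then show "\<bar>r n j - f (of_int k / real m)\<bar> \<le> \<epsilon>" using fk by linarith
      qed
      then show ?case by (simp add: gm_def k_def)
    qed
    then show ?thesis by (rule tendsto_eventually)
  qed
  have fm_step: "m > 0 \<Longrightarrow> (\<lambda>n. \<Sum>j<N n. w n j * fm m (x n j)) \<longlonglongrightarrow> (\<integral>u. fm m u \<partial>\<nu>)" "m > 0 \<Longrightarrow> integrable \<nu> (fm m)"
    and gm_step: "m > 0 \<Longrightarrow> (\<lambda>n. \<Sum>j<N n. w n j * gm m (x n j)) \<longlonglongrightarrow> (\<integral>u. gm m u \<partial>\<nu>)" "m > 0 \<Longrightarrow> integrable \<nu> (gm m)" for m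
    unfolding fm_def[abs_def] gm_def[abs_def]
    using weighted_step_function_tendsto[of m "\<lambda>k. f (of_int k / real m)" t]
      weighted_step_function_tendsto[of m "\<lambda>k. if Good m k then \<epsilon> else 2 * \<bar>C\<bar>" t] by auto
  have "(\<lambda>m. \<integral>u. gm (Suc m) u \<partial>\<nu>) \<longlonglongrightarrow> (\<integral>u. \<epsilon> * indicator {0..<t} u \<partial>\<nu>)"
  proof (rule integral_dominated_convergence[where w = "\<lambda>_. \<epsilon> + 2 * \<bar>C\<bar>"])
    show "AE u in \<nu>. (\<lambda>m. gm (Suc m) u) \<longlonglongrightarrow> \<epsilon> * indicator {0..<t} u"
      using AE_X by eventually_elim (use gm_tendsto LIMSEQ_Suc in blast)
    show "AE u in \<nu>. norm (gm (Suc m) u) \<le> \<epsilon> + 2 * \<bar>C\<bar>" for m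
      using eps by (intro always_eventually) (auto simp: gm_def indicator_def)
    show "gm (Suc m) \<in> borel_measurable \<nu>" for m
      using gm_step(2)[of "Suc m"] by auto
  qed (auto simp: measurable_cong_sets[OF M_is_borel refl])
  moreover have "(\<integral>u. \<epsilon> * indicator {0..<t} u \<partial>\<nu>) = \<epsilon> * L" by (simp add: L_def)
  ultimately have "eventually (\<lambda>m. (\<integral>u. gm (Suc m) u \<partial>\<nu>) < e / 3) sequentially"
    using order_tendstoD(2) epsL by metis
  \<comment> \<open>The grid is fixed here, before n tends to infinity; for fixed m all sums over
    step functions converge.\<close>
  then obtain m where m0: "m > 0" and m: "(\<integral>u. gm m u \<partial>\<nu>) < e / 3"
    unfolding eventually_sequentially by blast
  have int_f: "integrable \<nu> (\<lambda>u. f u * indicator {0..<t} u)"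
    by (rule integrable_const_bound[where B = "\<bar>C\<bar>"])
      (use f_bound f_meas in \<open>auto simp: indicator_def measurable_cong_sets[OF M_is_borel refl] intro: order_trans[OF _ abs_ge_self]\<close>)
  have f_diff: "\<bar>f u * indicator {0..<t} u - fm m u\<bar> \<le> gm m u" for u
  proof (cases "u \<in> {0..<t}")
    case True
    define k where "k = \<lfloor>real m * u\<rfloor>"
    have "real_of_int k \<le> real m * u" "0 \<le> k" using True by (auto simp: k_def)
    then have "of_int k / real m \<in> {0..<t}"
      using True m0 by (auto simp: divide_less_eq mult.commute intro: le_less_trans)
    then have "\<bar>f (of_int k / real m)\<bar> \<le> C" "\<bar>f u\<bar> \<le> C" using f_bound True by blast+
    then show ?thesis using True by (auto simp: gm_def fm_def Good_def k_def)
  qed (auto simp: gm_def fm_def)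
  have "\<bar>?I - (\<integral>u. fm m u \<partial>\<nu>)\<bar> = \<bar>\<integral>u. f u * indicator {0..<t} u - fm m u \<partial>\<nu>\<bar>"
    using int_f fm_step(2)[OF m0] by (subst Bochner_Integration.integral_diff) auto
  also have "\<dots> \<le> (\<integral>u. gm m u \<partial>\<nu>)"
    using f_diff int_f fm_step(2)[OF m0] gm_step(2)[OF m0]
    by (intro order_trans[OF integral_abs_bound] integral_mono) auto
  finally have I: "\<bar>?I - (\<integral>u. fm m u \<partial>\<nu>)\<bar> < e / 3" using m by linarith
  obtain n1 where n1: "\<And>n j. n \<ge> n1 \<Longrightarrow> j < N n \<Longrightarrow> x n j < t \<Longrightarrow> \<bar>r n j\<bar> \<le> C"
    using r_bound by blast
  have "eventually (\<lambda>n. n \<ge> max m n1) sequentially" by (rule eventually_ge_at_top)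
  moreover have "eventually (\<lambda>n. (\<Sum>j<N n. w n j * gm m (x n j)) < e / 3) sequentially"
    using gm_step(1)[OF m0] m by (rule order_tendstoD)
  moreover have "eventually (\<lambda>n. dist (\<Sum>j<N n. w n j * fm m (x n j)) (\<integral>u. fm m u \<partial>\<nu>) < e / 3) sequentially"
    using e by (intro tendstoD[OF fm_step(1)[OF m0]]) auto
  ultimately show "eventually (\<lambda>n. dist (?A n) ?I < e) sequentially"
  proof eventually_elim
    case (elim n)
    have r_diff: "\<bar>r n j * indicator {0..<t} (x n j) - fm m (x n j)\<bar> \<le> gm m (x n j)" if j: "j < N n" for j
    proof (cases "x n j < t")
      case True
      define k where "k = \<lfloor>real m * x n j\<rfloor>"
      have x0: "0 \<le> x n j" using nodes j by simp
      have "real_of_int k \<le> real m * x n j" "0 \<le> k" using x0 by (auto simp: k_def)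
      then have "of_int k / real m \<in> {0..<t}"
        using True m0 by (auto simp: divide_less_eq mult.commute intro: le_less_trans)
      then have "\<bar>f (of_int k / real m)\<bar> \<le> C" "\<bar>r n j\<bar> \<le> C"
        using f_bound True n1 elim j by auto
      then show ?thesis using True elim j x0 by (auto simp: gm_def fm_def Good_def k_def)
    qed (auto simp: gm_def fm_def)
    have "\<bar>?A n - (\<Sum>j<N n. w n j * fm m (x n j))\<bar> =
        \<bar>\<Sum>j<N n. w n j * (r n j * indicator {0..<t} (x n j) - fm m (x n j))\<bar>"
      by (simp only: right_diff_distrib sum_subtractf)
    also have "\<dots> \<le> (\<Sum>j<N n. w n j * gm m (x n j))"
      using r_diff weight_nonneg
      by (intro order_trans[OF sum_abs] sum_mono) (auto simp: abs_mult intro!: mult_left_mono)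
    finally show ?case using elim I unfolding dist_real_def by linarith
  qed
qed

end

section \<open>The variation measure\<close>

lemma partition_nth_less:
  "is_partition T P \<Longrightarrow> i < j \<Longrightarrow> j \<le> num_intervals P \<Longrightarrow> P ! i < P ! j"
  by (auto simp: is_partition_def num_intervals_def sorted_wrt_iff_nth_less Suc_diff_Suc
      length_greater_0_conv less_Suc_eq_le dest: diff_Suc_less)

lemma partition_nth_mono:
  "is_partition T P \<Longrightarrow> i \<le> j \<Longrightarrow> j \<le> num_intervals P \<Longrightarrow> P ! i \<le> P ! j"
  using partition_nth_less[of T P i j] by (cases "i = j") auto

lemma partition_nth_0: "is_partition T P \<Longrightarrow> P ! 0 = 0"
  by (auto simp: is_partition_def hd_conv_nth)

lemma partition_nth_last: "is_partition T P \<Longrightarrow> P ! num_intervals P = T"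
  by (auto simp: is_partition_def num_intervals_def last_conv_nth)

lemma partition_nth_mem: "is_partition T P \<Longrightarrow> j \<le> num_intervals P \<Longrightarrow> P ! j \<in> {0..T}"
  using partition_nth_mono[of T P 0 j] partition_nth_mono[of T P j "num_intervals P"]
  by (simp add: partition_nth_0 partition_nth_last)

lemma partition_num_intervals_pos: "is_partition T P \<Longrightarrow> 0 < T \<Longrightarrow> 0 < num_intervals P"
  using partition_nth_0[of T P] partition_nth_last[of T P] by (cases "num_intervals P = 0") auto

lemma integral_variation_measure:
  assumes P: "is_partition T P" and f: "continuous_on {0..T} f"
  shows "integral\<^sup>L (variation_measure T p P S) f =
    (\<Sum>j<num_intervals P. \<bar>S (P ! Suc j) - S (P ! j)\<bar> ^ p * f (P ! j))"
proof -
  have "f \<in> borel_measurable (restrict_space borel {0..T})"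
    by (rule borel_measurable_continuous_on_restrict[OF f])
  moreover have "(\<lambda>j. P ! j) \<in> point_measure {..<num_intervals P} w \<rightarrow>\<^sub>M restrict_space borel {0..T}" for w
    using partition_nth_mem[OF P] by (auto simp: space_restrict_space)
  ultimately have "integral\<^sup>L (variation_measure T p P S) f =
      (\<integral>j. f (P ! j) \<partial>point_measure {..<num_intervals P} (\<lambda>j. ennreal (\<bar>S (P ! Suc j) - S (P ! j)\<bar> ^ p)))"
    unfolding variation_measure_def by (subst integral_distr) auto
  then show ?thesis by (subst (asm) lebesgue_integral_point_measure_finite) auto
qed

text \<open>The limit measure lives on the trace of the Borel sets on [0, T]; pushing it forward
  along the inclusion yields a Borel measure on the line. Points outside [0, T] have empty preimage,
  and ramps restrict to admissible test functions.\<close>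

lemma weighted_nodes_limit_variation:
  assumes lim: "is_limit_variation T p \<pi> S \<mu>" and P: "\<And>n. is_partition T (\<pi> n)"
  shows "weighted_nodes_limit (distr \<mu> borel (\<lambda>u. u)) (\<lambda>n. num_intervals (\<pi> n)) (\<lambda>n j. \<pi> n ! j)
    (\<lambda>n j. \<bar>S (\<pi> n ! Suc j) - S (\<pi> n ! j)\<bar> ^ p)"
proof -
  interpret finite_measure \<mu> using lim by (simp add: is_limit_variation_def)
  have sets: "sets \<mu> = sets (restrict_space borel {0..T})"
    using lim by (simp add: is_limit_variation_def)
  then have space: "space \<mu> = {0..T}"
    using sets_eq_imp_space_eq[OF sets] by (simp add: space_restrict_space)
  have id: "(\<lambda>u. u) \<in> \<mu> \<rightarrow>\<^sub>M borel"
    unfolding measurable_cong_sets[OF sets refl] by (rule measurable_restrict_space1) simp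
  interpret \<nu>: finite_measure "distr \<mu> borel (\<lambda>u. u)"
    using id by (rule finite_measure_distr)
  show ?thesis
  proof
    fix a
    show "measure (distr \<mu> borel (\<lambda>u. u)) {a} = 0"
    proof (cases "a \<in> {0..T}")
      case True
      then show ?thesis
        using lim id by (subst measure_distr) (auto simp: is_limit_variation_def measure_def space)
    qed (use id in \<open>auto simp: measure_distr space\<close>)
  next
    fix a b :: real assume "a < b"
    have "(\<lambda>n. integral\<^sup>L (variation_measure T p (\<pi> n) S) (left_ramp a b))
        \<longlonglongrightarrow> integral\<^sup>L \<mu> (left_ramp a b)"
      using lim continuous_on_left_ramp by (auto simp: is_limit_variation_def weakly_converges_def)
    moreover have "integral\<^sup>L (distr \<mu> borel (\<lambda>u. u)) (left_ramp a b) = integral\<^sup>L \<mu> (left_ramp a b)"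
      using id by (subst integral_distr)
        (auto intro!: borel_measurable_continuous_onI continuous_on_left_ramp)
    ultimately show "(\<lambda>n. \<Sum>j<num_intervals (\<pi> n). \<bar>S (\<pi> n ! Suc j) - S (\<pi> n ! j)\<bar> ^ p *
        left_ramp a b (\<pi> n ! j)) \<longlonglongrightarrow> integral\<^sup>L (distr \<mu> borel (\<lambda>u. u)) (left_ramp a b)"
      by (simp add: integral_variation_measure[OF P] continuous_on_left_ramp)
  qed auto
qed

text \<open>Both distribution functions are limits of the same discrete sums, so the two
  pushed-forward measures agree, and every measurable subset of [0, T] is its own preimage. This is
  what gives the \<open>THE\<close> in \<open>pvariation\<close> a meaning.\<close>

lemma is_limit_variation_unique:
  assumes "is_limit_variation T p \<pi> S \<mu>" "is_limit_variation T p \<pi> S \<mu>'"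
    and P: "\<And>n. is_partition T (\<pi> n)"
  shows "\<mu> = \<mu>'"
proof -
  interpret A: weighted_nodes_limit "distr \<mu> borel (\<lambda>u. u)" "\<lambda>n. num_intervals (\<pi> n)" "\<lambda>n j. \<pi> n ! j"
    "\<lambda>n j. \<bar>S (\<pi> n ! Suc j) - S (\<pi> n ! j)\<bar> ^ p"
    using weighted_nodes_limit_variation[OF assms(1) P] .
  interpret B: weighted_nodes_limit "distr \<mu>' borel (\<lambda>u. u)" "\<lambda>n. num_intervals (\<pi> n)" "\<lambda>n j. \<pi> n ! j"
    "\<lambda>n j. \<bar>S (\<pi> n ! Suc j) - S (\<pi> n ! j)\<bar> ^ p"
    using weighted_nodes_limit_variation[OF assms(2) P] .
  have "cdf (distr \<mu> borel (\<lambda>u. u)) = cdf (distr \<mu>' borel (\<lambda>u. u))"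
    using LIMSEQ_unique[OF A.weight_below_tendsto_cdf B.weight_below_tendsto_cdf] by (rule ext)
  then have eq: "distr \<mu> borel (\<lambda>u. u) = distr \<mu>' borel (\<lambda>u. u)"
    by (intro cdf_unique' A.finite_borel_measure_axioms B.finite_borel_measure_axioms)
  have em: "emeasure M A = emeasure (distr M borel (\<lambda>u. u)) A"
    if M: "sets M = sets (restrict_space borel {0..T})" and A: "A \<in> sets M" for M :: "real measure" and A
  proof -
    have "(\<lambda>u. u) \<in> M \<rightarrow>\<^sub>M borel"
      unfolding measurable_cong_sets[OF M refl] by (rule measurable_restrict_space1) simp
    moreover have "A \<in> sets borel"
      using A unfolding M by (auto simp: sets_restrict_space)
    moreover have "A \<inter> space M = A" using sets.sets_into_space[OF A] by auto
    ultimately show ?thesis by (simp add: emeasure_distr)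
  qed
  have sets: "sets \<mu> = sets (restrict_space borel {0..T})" "sets \<mu>' = sets (restrict_space borel {0..T})"
    using assms by (auto simp: is_limit_variation_def)
  show ?thesis
    by (rule measure_eqI) (use sets in \<open>auto simp: em eq\<close>)
qed

text \<open>The function [S]^p, extended constantly outside [0, T], is the distribution function of
  the pushed-forward limit measure, and its Lebesgue-Stieltjes measure gives that measure back. From
  here on the integral against d[S]^p is an integral against the weak limit.\<close>

lemma interval_measure_pvariation:
  assumes lim: "is_limit_variation T p \<pi> S \<mu>" and P: "\<And>n. is_partition T (\<pi> n)"
  shows "interval_measure (pvariation T p \<pi> S) = distr \<mu> borel (\<lambda>u. u)"
proof -
  interpret \<nu>: weighted_nodes_limit "distr \<mu> borel (\<lambda>u. u)" "\<lambda>n. num_intervals (\<pi> n)" "\<lambda>n j. \<pi> n ! j"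
    "\<lambda>n j. \<bar>S (\<pi> n ! Suc j) - S (\<pi> n ! j)\<bar> ^ p"
    using weighted_nodes_limit_variation[OF lim P] .
  let ?\<nu> = "distr \<mu> borel (\<lambda>u. u)"
  have the: "(THE \<mu>. is_limit_variation T p \<pi> S \<mu>) = \<mu>"
    using lim is_limit_variation_unique[OF _ lim P] by (rule the_equality)
  have sets: "sets \<mu> = sets (restrict_space borel {0..T})"
    using lim by (simp add: is_limit_variation_def)
  then have space: "space \<mu> = {0..T}"
    using sets_eq_imp_space_eq[OF sets] by (simp add: space_restrict_space)
  have id: "(\<lambda>u. u) \<in> \<mu> \<rightarrow>\<^sub>M borel"
    unfolding measurable_cong_sets[OF sets refl] by (rule measurable_restrict_space1) simp
  have "pvariation T p \<pi> S t = cdf ?\<nu> t" for t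
  proof -
    have "{0..t} \<inter> {0..T} = {..t} \<inter> space \<mu>" by (auto simp: space)
    then show ?thesis unfolding pvariation_def the cdf_def by (simp add: measure_distr id)
  qed
  then have pv: "pvariation T p \<pi> S = cdf ?\<nu>" by (rule ext)
  have "finite_borel_measure (interval_measure (cdf ?\<nu>))"
    by (rule finite_borel_measure_interval_measure)
      (use \<nu>.cdf_nondecreasing \<nu>.cdf_is_right_cont \<nu>.cdf_lim_at_bot \<nu>.cdf_lim_at_top in auto)
  moreover have "cdf (interval_measure (cdf ?\<nu>)) = cdf ?\<nu>"
    by (rule cdf_interval_measure)
      (use \<nu>.cdf_nondecreasing \<nu>.cdf_is_right_cont \<nu>.cdf_lim_at_bot in auto)
  ultimately show ?thesis
    unfolding pv by (intro cdf_unique' \<nu>.finite_borel_measure_axioms)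
qed

section \<open>Right derivatives\<close>

text \<open>One-sided mean value inequality. With slope C + e, the points where the bound holds form
  a closed set; if its supremum lay before b, the right derivative there, being below C + e, would
  carry the bound further right.\<close>

lemma right_derivative_le_imp_increment_le:
  fixes g d :: "real \<Rightarrow> real"
  assumes "a \<le> b" and cont: "continuous_on {a..b} g"
    and deriv: "\<And>x. x \<in> {a..<b} \<Longrightarrow> ((\<lambda>h. (g (x + h) - g x) / h) \<longlongrightarrow> d x) (at_right 0)"
    and le: "\<And>x. x \<in> {a..<b} \<Longrightarrow> d x \<le> C"
  shows "g b - g a \<le> C * (b - a)"
proof -
  have *: "g b - g a \<le> (C + e) * (b - a)" if "e > 0" for e
  proof -
    define h where "h x = g x - g a - (C + e) * (x - a)" for x
    define Z where "Z = {x \<in> {a..b}. h x \<le> 0}"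
    have closed: "closed Z"
      unfolding Z_def h_def by (intro continuous_on_closed_Collect_le continuous_intros cont)
    have "a \<in> Z" using assms(1) by (simp add: Z_def h_def)
    have bdd: "bdd_above Z" by (auto simp: Z_def)
    have s: "Sup Z \<in> Z" using closed_contains_Sup[OF _ bdd closed] \<open>a \<in> Z\<close> by blast
    have "Sup Z = b"
    proof (rule ccontr)
      assume "Sup Z \<noteq> b"
      with s have s': "Sup Z \<in> {a..<b}" by (auto simp: Z_def)
      define s where "s = Sup Z"
      have "eventually (\<lambda>k. (g (s + k) - g s) / k < C + e) (at_right 0)"
        using le[OF s'] \<open>e > 0\<close> by (intro order_tendstoD(2)[OF deriv]) (use s' s_def in auto)
      moreover have "eventually (\<lambda>k. k \<in> {0<..<b - s}) (at_right 0)"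
        using s' s_def by (intro eventually_at_right_real) auto
      ultimately have "eventually (\<lambda>k. s + k \<in> Z \<and> 0 < k) (at_right 0)"
      proof eventually_elim
        case (elim k)
        then have "g (s + k) - g s < (C + e) * k" by (simp add: divide_less_eq)
        moreover have "h s \<le> 0" using s by (simp add: s_def Z_def)
        ultimately show ?case using elim s' by (auto simp: Z_def h_def s_def algebra_simps)
      qed
      then obtain k where k: "s + k \<in> Z" "0 < k"
        using eventually_happens'[OF trivial_limit_at_right_real] by blast
      then show False using cSup_upper[OF k(1) bdd] by (simp add: s_def)
    qed
    then show ?thesis using s by (simp add: Z_def h_def)
  qed
  show ?thesis
  proof (rule field_le_epsilon)
    fix e :: real assume "e > 0"
    \<comment> \<open>The slack is scaled so that it adds up to at most e over [a, b], also when a =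
      b.\<close>
    then have "g b - g a \<le> (C + e / (b - a + 1)) * (b - a)"
      using assms(1) by (intro *) simp
    also have "\<dots> \<le> C * (b - a) + e"
      using assms(1) \<open>e > 0\<close> by (simp add: field_simps)
    finally show "g b - g a \<le> C * (b - a) + e" .
  qed
qed

lemma right_derivative_bounded_imp_lipschitz:
  fixes g d :: "real \<Rightarrow> real"
  assumes "a \<le> b" and cont: "continuous_on {a..b} g"
    and deriv: "\<And>x. x \<in> {a..<b} \<Longrightarrow> ((\<lambda>h. (g (x + h) - g x) / h) \<longlongrightarrow> d x) (at_right 0)"
    and le: "\<And>x. x \<in> {a..<b} \<Longrightarrow> \<bar>d x\<bar> \<le> C"
  shows "\<bar>g b - g a\<bar> \<le> C * (b - a)"
proof -
  have "((\<lambda>h. (- g (x + h) - - g x) / h) \<longlongrightarrow> - d x) (at_right 0)" if "x \<in> {a..<b}" for x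
    using tendsto_minus[OF deriv[OF that]] by (simp add: minus_divide_left)
  moreover have "- d x \<le> C" "d x \<le> C" if "x \<in> {a..<b}" for x using le[OF that] by auto
  ultimately have "- g b - - g a \<le> C * (b - a)"
    using assms(1) cont by (intro right_derivative_le_imp_increment_le[where d = "\<lambda>x. - d x"] continuous_on_minus)
  moreover have "g b - g a \<le> C * (b - a)"
    using assms(1) cont deriv le by (intro right_derivative_le_imp_increment_le[where d = d]) (auto simp: abs_le_iff)
  ultimately show ?thesis by linarith
qed

text \<open>The right derivative need not be continuous. The integral of the difference quotient of step \<open>h\<close>
  is a difference of averages of \<open>g\<close> over intervals of length \<open>h\<close>, and dominated convergence applies
  as \<open>g\<close> is Lipschitz.\<close>

lemma right_derivative_integral:
  fixes g d :: "real \<Rightarrow> real"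
  assumes "a \<le> b" and cont: "continuous_on {a..b} g"
    and deriv: "\<And>x. x \<in> {a..<b} \<Longrightarrow> ((\<lambda>h. (g (x + h) - g x) / h) \<longlongrightarrow> d x) (at_right 0)"
    and le: "\<And>x. x \<in> {a..<b} \<Longrightarrow> \<bar>d x\<bar> \<le> C"
  shows "set_integrable lborel {a..<b} d" "(LINT x:{a..<b}|lborel. d x) = g b - g a"
proof -
  \<comment> \<open>Constant extension, so that difference quotients make sense up to b. Past b it
    adds no increment, hence the Lipschitz bound of g still dominates all quotients.\<close>
  define G where "G x = g (max a (min b x))" for x
  have G_cont: "continuous_on A G" for A
    unfolding G_def by (rule continuous_on_compose2[OF cont]) (use assms(1) in \<open>auto intro!: continuous_intros\<close>)
  have G_meas: "G \<in> borel_measurable borel"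
    by (rule borel_measurable_continuous_onI[OF G_cont])
  have lip: "\<bar>g y - g x\<bar> \<le> C * (y - x)" if "a \<le> x" "x \<le> y" "y \<le> b" for x y
    using that by (intro right_derivative_bounded_imp_lipschitz[where d = d] continuous_on_subset[OF cont] deriv le) auto
  define h where "h n = inverse (real (Suc n))" for n
  have h0: "h n > 0" "h n \<le> 1" for n by (auto simp: h_def inverse_le_1_iff)
  have h_lim: "filterlim h (at_right 0) sequentially"
    unfolding filterlim_at using LIMSEQ_inverse_real_of_nat h0 by (auto simp: h_def[abs_def])
  define q where "q n x = indicator {a..<b} x * ((G (x + h n) - G x) / h n)" for n x
  have q_meas: "q n \<in> borel_measurable lborel" for n
    unfolding q_def[abs_def]
    by (intro borel_measurable_times borel_measurable_divide borel_measurable_diff)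
      (auto intro: measurable_compose[OF _ G_meas])
  have q_lim: "(\<lambda>n. q n x) \<longlonglongrightarrow> indicator {a..<b} x * d x" for x
  proof (cases "x \<in> {a..<b}")
    case True
    have "(\<lambda>n. (g (x + h n) - g x) / h n) \<longlonglongrightarrow> d x"
      using filterlim_compose[OF deriv[OF True] h_lim] .
    moreover have "eventually (\<lambda>n. h n < b - x) sequentially"
      using True LIMSEQ_inverse_real_of_nat by (auto simp: h_def[abs_def] intro: order_tendstoD)
    then have "eventually (\<lambda>n. (g (x + h n) - g x) / h n = q n x) sequentially"
    proof eventually_elim
      case (elim n)
      have "min b (x + h n) = x + h n" "max a (x + h n) = x + h n" "min b x = x" "max a x = x"
        using True elim h0(1)[of n] by auto
      then show ?case using True by (simp add: q_def G_def)
    qed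
    ultimately show ?thesis using True by (auto intro: Lim_transform_eventually)
  qed (simp add: q_def)
  have q_bound: "\<bar>q n x\<bar> \<le> indicator {a..<b} x * C" for n x
  proof (cases "x \<in> {a..<b}")
    case True
    define y where "y = min b (x + h n)"
    have y: "x \<le> y" "y \<le> b" "y - x \<le> h n" using True h0[of n] by (auto simp: y_def)
    have C: "0 \<le> C" using le[OF True] by linarith
    have "G (x + h n) = g y" "G x = g x"
      using True h0[of n] by (auto simp: G_def y_def max_def min_def)
    then have "\<bar>G (x + h n) - G x\<bar> \<le> C * (y - x)" using lip True y by auto
    also have "\<dots> \<le> C * h n" using C y by (intro mult_left_mono) auto
    finally show ?thesis using True h0[of n] by (simp add: q_def divide_le_eq abs_mult)
  qed (simp add: q_def)
  have w: "integrable lborel (\<lambda>x. indicator {a..<b} x * C)"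
    by (intro integrable_mult_left integrable_real_indicator) (use assms(1) in auto)
  have d_meas: "(\<lambda>x. indicator {a..<b} x * d x) \<in> borel_measurable lborel"
    using q_lim q_meas by (rule borel_measurable_LIMSEQ_real)
  have AE_lim: "AE x in lborel. (\<lambda>n. q n x) \<longlonglongrightarrow> indicator {a..<b} x * d x"
    and AE_bound: "AE x in lborel. norm (q n x) \<le> indicator {a..<b} x * C" for n
    using q_lim q_bound by auto
  note dc = integrable_dominated_convergence[OF d_meas q_meas w AE_lim AE_bound]
    integral_dominated_convergence[OF d_meas q_meas w AE_lim AE_bound]
  \<comment> \<open>The enlarged interval makes the derivative two-sided on [a, b+1], which contains
    every x + h n with x in [a, b] because h n \<le> 1.\<close>
  obtain \<Phi> where \<Phi>: "\<And>x. x \<in> {a - 1..b + 2} \<Longrightarrow> (\<Phi> has_vector_derivative G x) (at x within {a - 1..b + 2})"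
    using antiderivative_continuous[OF G_cont] by blast
  have D: "DERIV \<Phi> x :> G x" if "x \<in> {a..b + 1}" for x
  proof -
    have "at x within {a - 1..b + 2} = at x"
      using that by (intro at_within_Icc_at) auto
    then show ?thesis using \<Phi>[of x] that
      by (auto simp: has_real_derivative_iff_has_vector_derivative)
  qed
  have q_int: "integral\<^sup>L lborel (q n) = (\<Phi> (b + h n) - \<Phi> b) / h n - (\<Phi> (a + h n) - \<Phi> a) / h n" for n
  proof -
    have int: "has_bochner_integral lborel (\<lambda>x. (G (x + h n) - G x) / h n * indicator {a..b} x)
        ((\<Phi> (b + h n) - \<Phi> b) / h n - (\<Phi> (a + h n) - \<Phi> a) / h n)"
    proof (rule has_bochner_integral_FTC_Icc_real[where F = "\<lambda>x. (\<Phi> (x + h n) - \<Phi> x) / h n"])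
      fix x assume x: "a \<le> x" "x \<le> b"
      have "DERIV (\<lambda>x. \<Phi> (x + h n)) x :> G (x + h n)"
        using D[of "x + h n"] x h0[of n] by (simp add: DERIV_shift)
      then show "DERIV (\<lambda>x. (\<Phi> (x + h n) - \<Phi> x) / h n) x :> (G (x + h n) - G x) / h n"
        using D[of x] x by (intro DERIV_cdivide DERIV_diff) auto
      have "continuous_on UNIV (\<lambda>x. (G (x + h n) - G x) / h n)"
        using h0[of n] by (intro continuous_intros continuous_on_compose2[OF G_cont[of UNIV]] G_cont) auto
      then show "isCont (\<lambda>x. (G (x + h n) - G x) / h n) x"
        by (simp add: continuous_on_eq_continuous_at)
    qed (use assms in auto)
    have "integral\<^sup>L lborel (q n) = (\<integral>x. (G (x + h n) - G x) / h n * indicator {a..b} x \<partial>lborel)"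
    proof (rule integral_cong_AE)
      have "AE x in lborel. x \<noteq> b" by (rule AE_lborel_singleton)
      then show "AE x in lborel. q n x = (G (x + h n) - G x) / h n * indicator {a..b} x"
        by eventually_elim (auto simp: q_def indicator_def)
      show "(\<lambda>x. (G (x + h n) - G x) / h n * indicator {a..b} x) \<in> borel_measurable lborel"
        by (intro borel_measurable_times borel_measurable_divide borel_measurable_diff)
          (auto intro: measurable_compose[OF _ G_meas])
    qed (rule q_meas)
    then show ?thesis using has_bochner_integral_integral_eq[OF int] by (rule trans)
  qed
  have quot: "(\<lambda>n. (\<Phi> (x + h n) - \<Phi> x) / h n) \<longlonglongrightarrow> G x" if "x \<in> {a..b}" for x
  proof -
    have "((\<lambda>k. (\<Phi> (x + k) - \<Phi> x) / k) \<longlongrightarrow> G x) (at_right 0)"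
      using D[of x] that unfolding DERIV_def by (auto intro: tendsto_mono[OF at_le])
    then show ?thesis using h_lim by (rule filterlim_compose)
  qed
  have "(\<lambda>n. integral\<^sup>L lborel (q n)) \<longlonglongrightarrow> G b - G a"
    unfolding q_int using assms(1) by (intro tendsto_diff quot) auto
  then have "(\<integral>x. indicator {a..<b} x * d x \<partial>lborel) = G b - G a"
    using LIMSEQ_unique dc(2) by blast
  then show "set_integrable lborel {a..<b} d" "(LINT x:{a..<b}|lborel. d x) = g b - g a"
    using dc(1) assms(1) by (simp_all add: set_integrable_def set_lebesgue_integral_def G_def)
qed

text \<open>After subtracting the line of slope d x, the right derivative is at most e/2 in absolute
  value near x, so the remaining function is Lipschitz there with constant e/2. That estimate is
  symmetric in its endpoints and therefore also controls the quotients from the left.\<close>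

lemma continuous_right_derivative_imp_DERIV:
  fixes g d :: "real \<Rightarrow> real"
  assumes cont: "continuous_on UNIV g" "isCont d x"
    and deriv: "\<And>x. ((\<lambda>h. (g (x + h) - g x) / h) \<longlongrightarrow> d x) (at_right 0)"
  shows "DERIV g x :> d x"
  unfolding has_field_derivative_iff
proof (rule LIM_I)
  fix e :: real assume e: "e > 0"
  then obtain s where s: "s > 0" "\<And>y. \<bar>y - x\<bar> < s \<Longrightarrow> \<bar>d y - d x\<bar> < e / 2"
    using cont(2) unfolding continuous_at_eps_delta dist_real_def by (metis half_gt_zero)
  have *: "\<bar>(g v - d x * v) - (g u - d x * u)\<bar> \<le> e / 2 * (v - u)" if "u \<le> v" "\<bar>u - x\<bar> < s" "\<bar>v - x\<bar> < s" for u v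
  proof (rule right_derivative_bounded_imp_lipschitz[OF \<open>u \<le> v\<close>])
    show "continuous_on {u..v} (\<lambda>y. g y - d x * y)"
      by (intro continuous_intros continuous_on_subset[OF cont(1)]) auto
    fix y assume y: "y \<in> {u..<v}"
    show "\<bar>d y - d x\<bar> \<le> e / 2" using that y by (intro less_imp_le s) auto
    have "((\<lambda>h. (g (y + h) - g y) / h - d x) \<longlongrightarrow> d y - d x) (at_right 0)"
      by (intro tendsto_intros deriv)
    moreover have "eventually (\<lambda>h. (g (y + h) - g y) / h - d x = (g (y + h) - d x * (y + h) - (g y - d x * y)) / h) (at_right 0)"
      by (rule eventually_at_rightI[of 0 1]) (auto simp: field_simps)
    ultimately show "((\<lambda>h. (g (y + h) - d x * (y + h) - (g y - d x * y)) / h) \<longlongrightarrow> d y - d x) (at_right 0)"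
      by (rule Lim_transform_eventually)
  qed
  show "\<exists>s>0. \<forall>y. y \<noteq> x \<and> norm (y - x) < s \<longrightarrow> norm ((g y - g x) / (y - x) - d x) < e"
  proof (intro exI[of _ s] conjI allI impI)
    fix y assume y: "y \<noteq> x \<and> norm (y - x) < s"
    have "\<bar>(g y - g x) - d x * (y - x)\<bar> \<le> e / 2 * \<bar>y - x\<bar>"
      using *[of x y] *[of y x] y s(1) by (cases "x \<le> y") (auto simp: algebra_simps abs_minus_commute)
    moreover have "(g y - g x) / (y - x) - d x = ((g y - g x) - d x * (y - x)) / (y - x)"
      using y by (simp add: field_simps)
    ultimately have "\<bar>(g y - g x) / (y - x) - d x\<bar> \<le> e / 2"
      using y by (simp add: abs_divide divide_le_eq)
    then show "norm ((g y - g x) / (y - x) - d x) < e" using e by simp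
  qed (rule s)
qed

section \<open>Functionals near a continuous path\<close>

lemma stopped_apply: "s \<in> {0..T} \<Longrightarrow> stopped T t \<omega> s = \<omega> (min s t)"
  by (simp add: stopped_def)

lemma stopped_stopped:
  "r \<in> {0..T} \<Longrightarrow> t \<in> {0..T} \<Longrightarrow> stopped T r (stopped T t \<omega>) = stopped T (min r t) \<omega>"
  by (auto simp: stopped_def fun_eq_iff min.assoc)

lemma stopped_in_Lambda: "t \<in> {0..T} \<Longrightarrow> \<omega> \<in> cadlag_paths T \<Longrightarrow> (t, stopped T t \<omega>) \<in> Lambda T"
  by (auto simp: Lambda_def)

lemma continuous_on_stopped:
  "continuous_on {0..T} S \<Longrightarrow> t \<in> {0..T} \<Longrightarrow> continuous_on {0..T} (stopped T t S)"
  by (rule continuous_on_eq[where f = "\<lambda>s. S (min s t)"])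
    (auto simp: stopped_def intro!: continuous_on_compose2[of "{0..T}" S] continuous_intros)

lemma continuous_imp_cadlag:
  assumes "continuous_on {0..T} \<omega>" "\<omega> \<in> extensional {0..T}"
  shows "\<omega> \<in> cadlag_paths T"
  unfolding cadlag_paths_def
proof (intro CollectI conjI ballI)
  fix t assume t: "t \<in> {0..<T}"
  have "continuous_on {t..T} \<omega>" by (rule continuous_on_subset[OF assms(1)]) (use t in auto)
  then show "(\<omega> \<longlongrightarrow> \<omega> t) (at_right t)" using t by (auto dest: continuous_on_Icc_at_rightD)
next
  fix t assume t: "t \<in> {0<..T}"
  have "continuous_on {0..t} \<omega>" by (rule continuous_on_subset[OF assms(1)]) (use t in auto)
  then show "\<exists>l. (\<omega> \<longlongrightarrow> l) (at_left t)" using t by (auto dest: continuous_on_Icc_at_leftD)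
qed (rule assms)

lemma stopped_continuous_cadlag:
  "continuous_on {0..T} S \<Longrightarrow> t \<in> {0..T} \<Longrightarrow> stopped T t S \<in> cadlag_paths T"
  by (intro continuous_imp_cadlag continuous_on_stopped) (auto simp: stopped_def)

lemma tendsto_indicator_atLeast_right:
  fixes a t :: real
  shows "(indicat_real {a..} \<longlongrightarrow> indicator {a..} t) (at_right t)"
proof (cases "a \<le> t")
  case True
  then show ?thesis
    by (intro tendsto_eventually eventually_at_rightI[of t "t + 1"]) (auto simp: indicator_def)
next
  case False
  then show ?thesis
    by (intro tendsto_eventually eventually_at_rightI[of t a]) (auto simp: indicator_def)
qed

lemma tendsto_indicator_atLeast_left:
  fixes a t :: real
  shows "(indicat_real {a..} \<longlongrightarrow> indicator {a<..} t) (at_left t)"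
proof (cases "a < t")
  case True
  then show ?thesis
    by (intro tendsto_eventually eventually_at_leftI[of a t]) (auto simp: indicator_def)
next
  case False
  then show ?thesis
    by (intro tendsto_eventually eventually_at_leftI[of "t - 1" t]) (auto simp: indicator_def)
qed

lemma cadlag_add_jump:
  assumes "\<omega> \<in> cadlag_paths T"
  shows "(\<lambda>s\<in>{0..T}. \<omega> s + c * indicator {a..} s) \<in> cadlag_paths T" (is "?\<omega>' \<in> _")
  unfolding cadlag_paths_def
proof (intro CollectI conjI ballI)
  fix t assume t: "t \<in> {0..<T}"
  have "((\<lambda>s. \<omega> s + c * indicator {a..} s) \<longlongrightarrow> \<omega> t + c * indicator {a..} t) (at_right t)"
    using assms t by (intro tendsto_intros tendsto_indicator_atLeast_right) (auto simp: cadlag_paths_def)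
  moreover have "eventually (\<lambda>s. \<omega> s + c * indicator {a..} s = ?\<omega>' s) (at_right t)"
    by (rule eventually_at_rightI[of t T]) (use t in auto)
  ultimately show "(?\<omega>' \<longlongrightarrow> ?\<omega>' t) (at_right t)"
    using t by (auto intro: Lim_transform_eventually)
next
  fix t assume t: "t \<in> {0<..T}"
  then obtain l where "(\<omega> \<longlongrightarrow> l) (at_left t)" using assms unfolding cadlag_paths_def by blast
  then have "((\<lambda>s. \<omega> s + c * indicator {a..} s) \<longlongrightarrow> l + c * indicator {a<..} t) (at_left t)"
    by (intro tendsto_intros tendsto_indicator_atLeast_left)
  moreover have "eventually (\<lambda>s. \<omega> s + c * indicator {a..} s = ?\<omega>' s) (at_left t)"
    by (rule eventually_at_leftI[of 0 t]) (use t in auto)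
  ultimately show "\<exists>l. (?\<omega>' \<longlongrightarrow> l) (at_left t)" by (blast intro: Lim_transform_eventually)
qed auto

lemma bumped_apply:
  "stopped T u \<omega> = \<omega> \<Longrightarrow> s \<in> {0..T} \<Longrightarrow> bumped T u h \<omega> s = \<omega> s + h * indicator {u..} s"
  by (auto simp: bumped_def indicator_def)

lemma bumped_cadlag:
  assumes "stopped T u \<omega> = \<omega>" "\<omega> \<in> cadlag_paths T"
  shows "bumped T u h \<omega> \<in> cadlag_paths T"
proof -
  have "bumped T u h \<omega> = (\<lambda>s\<in>{0..T}. \<omega> s + h * indicator {u..} s)"
    using assms(1) by (auto simp: bumped_def indicator_def fun_eq_iff)
  then show ?thesis using cadlag_add_jump[OF assms(2)] by simp
qed

lemma stopped_bumped:
  assumes "stopped T u \<omega> = \<omega>" "u \<in> {0..T}"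
  shows "stopped T u (bumped T u h \<omega>) = bumped T u h \<omega>"
proof
  fix s
  show "stopped T u (bumped T u h \<omega>) s = bumped T u h \<omega> s"
  proof (cases "s \<in> {0..T}")
    case True
    then have "\<omega> (min s u) = \<omega> s" using assms by (metis stopped_apply)
    then show ?thesis
      using True assms by (auto simp: stopped_apply bumped_apply indicator_def min_def split: if_splits)
  qed (auto simp: stopped_def bumped_def)
qed

lemma bumped_bumped:
  assumes "stopped T u \<omega> = \<omega>" "u \<in> {0..T}"
  shows "bumped T u h (bumped T u x \<omega>) = bumped T u (x + h) \<omega>"
proof
  fix s
  show "bumped T u h (bumped T u x \<omega>) s = bumped T u (x + h) \<omega> s"
  proof (cases "s \<in> {0..T}")
    case True
    then show ?thesis
      using assms by (simp add: bumped_apply stopped_bumped algebra_simps)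
  qed (auto simp: bumped_def)
qed

lemma bumped_0: "bumped T u 0 \<omega> = stopped T u \<omega>"
  by (auto simp: bumped_def stopped_def fun_eq_iff)

section \<open>Continuity and boundedness of functionals on tubes around the path\<close>

lemma d_sup_le: "0 \<le> T \<Longrightarrow> (\<And>s. s \<in> {0..T} \<Longrightarrow> \<bar>\<omega> s - \<omega>' s\<bar> \<le> c) \<Longrightarrow> d_sup T \<omega> \<omega>' \<le> c"
  unfolding d_sup_def by (intro cSUP_least) auto

lemma C00_left_continuous:
  assumes "G \<in> C00_left T" "t \<in> {0..T}" "\<omega> \<in> cadlag_paths T" "stopped T t \<omega> = \<omega>" "\<epsilon> > 0"
  shows "\<exists>\<delta>>0. \<forall>\<omega>'\<in>cadlag_paths T. stopped T t \<omega>' = \<omega>' \<longrightarrow>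
    (\<forall>s\<in>{0..T}. \<bar>\<omega> s - \<omega>' s\<bar> \<le> \<delta>) \<longrightarrow> \<bar>G (t, \<omega>) - G (t, \<omega>')\<bar> < \<epsilon>"
proof -
  have "\<forall>t\<in>{0..T}. \<forall>\<omega>\<in>cadlag_paths T. \<forall>\<epsilon>>0. \<exists>\<delta>>0. \<forall>\<omega>'\<in>cadlag_paths T.
        d_sup T \<omega> \<omega>' < \<delta> \<longrightarrow> \<bar>G (t, stopped T t \<omega>) - G (t, stopped T t \<omega>')\<bar> < \<epsilon>"
    using assms(1) unfolding C00_left_def by blast
  then obtain \<delta> where \<delta>: "\<delta> > 0" "\<And>\<omega>'. \<omega>' \<in> cadlag_paths T \<Longrightarrow> d_sup T \<omega> \<omega>' < \<delta> \<Longrightarrow>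
      \<bar>G (t, stopped T t \<omega>) - G (t, stopped T t \<omega>')\<bar> < \<epsilon>"
    using assms by blast
  have "\<bar>G (t, \<omega>) - G (t, \<omega>')\<bar> < \<epsilon>"
    if "\<omega>' \<in> cadlag_paths T" "stopped T t \<omega>' = \<omega>'" "\<forall>s\<in>{0..T}. \<bar>\<omega> s - \<omega>' s\<bar> \<le> \<delta> / 2" for \<omega>'
  proof -
    have "d_sup T \<omega> \<omega>' \<le> \<delta> / 2" using assms(2) that by (intro d_sup_le) auto
    then have "d_sup T \<omega> \<omega>' < \<delta>" using \<delta>(1) by linarith
    then show ?thesis using \<delta>(2)[OF that(1)] that(2) assms(4) by simp
  qed
  then show ?thesis using \<delta>(1) by (intro exI[of _ "\<delta> / 2"]) auto
qed

text \<open>For paths already stopped at their own times, the distance \<open>d_infty\<close>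
  reduces to a plain sup distance plus the time gap; half of the original radius is given to
  each.\<close>

lemma C00_left_left_continuous:
  assumes "G \<in> C00_left T" "t \<in> {0..T}" "\<omega> \<in> cadlag_paths T" "stopped T t \<omega> = \<omega>" "\<epsilon> > 0"
  shows "\<exists>\<delta>>0. \<forall>u\<in>{0..<t}. \<forall>\<omega>'\<in>cadlag_paths T. t - \<delta> < u \<longrightarrow> stopped T u \<omega>' = \<omega>' \<longrightarrow>
    (\<forall>s\<in>{0..T}. \<bar>\<omega> s - \<omega>' s\<bar> \<le> \<delta>) \<longrightarrow> \<bar>G (t, \<omega>) - G (u, \<omega>')\<bar> < \<epsilon>"
proof -
  have "\<forall>(t, \<omega>)\<in>Lambda T. \<forall>\<epsilon>>0. \<exists>\<delta>>0. \<forall>(t', \<omega>')\<in>Lambda T.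
        t' < t \<and> d_infty T (t, \<omega>) (t', \<omega>') < \<delta> \<longrightarrow> \<bar>G (t, \<omega>) - G (t', \<omega>')\<bar> < \<epsilon>"
    using assms(1) unfolding C00_left_def by blast
  moreover have "(t, \<omega>) \<in> Lambda T" using stopped_in_Lambda[OF assms(2,3)] assms(4) by simp
  ultimately have "\<forall>\<epsilon>>0. \<exists>\<delta>>0. \<forall>(t', \<omega>')\<in>Lambda T.
        t' < t \<and> d_infty T (t, \<omega>) (t', \<omega>') < \<delta> \<longrightarrow> \<bar>G (t, \<omega>) - G (t', \<omega>')\<bar> < \<epsilon>"
    by fast
  then obtain \<delta> where \<delta>: "\<delta> > 0" "\<And>t' \<omega>'. (t', \<omega>') \<in> Lambda T \<Longrightarrow> t' < t \<Longrightarrow>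
      d_infty T (t, \<omega>) (t', \<omega>') < \<delta> \<Longrightarrow> \<bar>G (t, \<omega>) - G (t', \<omega>')\<bar> < \<epsilon>"
    using assms(5) by fast
  have "\<bar>G (t, \<omega>) - G (u, \<omega>')\<bar> < \<epsilon>"
    if u: "u \<in> {0..<t}" "t - \<delta> / 2 < u" and \<omega>': "\<omega>' \<in> cadlag_paths T" "stopped T u \<omega>' = \<omega>'"
      "\<forall>s\<in>{0..T}. \<bar>\<omega> s - \<omega>' s\<bar> \<le> \<delta> / 2" for u \<omega>'
  proof (rule \<delta>(2))
    show "(u, \<omega>') \<in> Lambda T" using stopped_in_Lambda[of u T \<omega>'] u \<omega>' assms(2) by simp
    show "u < t" using u by simp
    have "\<omega> (min s t) = \<omega> s" "\<omega>' (min s u) = \<omega>' s" if "s \<in> {0..T}" for s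
      using that assms(4) \<omega>'(2) by (metis stopped_apply)+
    then have "(SUP s\<in>{0..T}. \<bar>\<omega> (min s t) - \<omega>' (min s u)\<bar>) \<le> \<delta> / 2"
      using assms(2) \<omega>'(3) by (intro cSUP_least) auto
    then show "d_infty T (t, \<omega>) (u, \<omega>') < \<delta>"
      using u by (simp add: d_infty_def)
  qed
  then show ?thesis using \<delta>(1) by (intro exI[of _ "\<delta> / 2"]) auto
qed

definition tube :: "real \<Rightarrow> (real \<Rightarrow> real) \<Rightarrow> real \<Rightarrow> real \<Rightarrow> (real \<Rightarrow> real) set" where
  "tube T S u \<delta> = {\<omega> \<in> cadlag_paths T. stopped T u \<omega> = \<omega> \<and> (\<forall>s\<in>{0..T}. \<bar>\<omega> s - S (min s u)\<bar> \<le> \<delta>)}"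

lemma tube_mono: "\<delta> \<le> \<delta>' \<Longrightarrow> tube T S u \<delta> \<subseteq> tube T S u \<delta>'"
  by (force simp: tube_def)

lemma stopped_in_tube:
  "continuous_on {0..T} S \<Longrightarrow> u \<in> {0..T} \<Longrightarrow> 0 \<le> \<delta> \<Longrightarrow> stopped T u S \<in> tube T S u \<delta>"
  by (auto simp: tube_def stopped_continuous_cadlag stopped_stopped stopped_apply)

lemma tube_continuous:
  assumes "G \<in> C00_left T" "continuous_on {0..T} S" "u \<in> {0..T}" "\<epsilon> > 0"
  shows "\<exists>\<delta>>0. \<forall>\<omega>\<in>tube T S u \<delta>. \<bar>G (u, \<omega>) - G (u, stopped T u S)\<bar> < \<epsilon>"
proof -
  obtain \<delta> where "\<delta> > 0" "\<forall>\<omega>'\<in>cadlag_paths T. stopped T u \<omega>' = \<omega>' \<longrightarrow>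
    (\<forall>s\<in>{0..T}. \<bar>stopped T u S s - \<omega>' s\<bar> \<le> \<delta>) \<longrightarrow> \<bar>G (u, stopped T u S) - G (u, \<omega>')\<bar> < \<epsilon>"
    using C00_left_continuous[OF assms(1,3) stopped_continuous_cadlag[OF assms(2,3)] _ assms(4)]
      assms(3) by (auto simp: stopped_stopped)
  then show ?thesis
    by (intro exI[of _ \<delta>]) (auto simp: tube_def stopped_apply abs_minus_commute)
qed

text \<open>The centre of the tube moves with u, whereas left-continuity at t compares with
  \<open>S\<close> stopped at t. Uniform continuity of \<open>S\<close> bridges the two centres;
  this is the origin of the second bound \<eta> on the radius.\<close>

lemma tube_left_continuous:
  assumes G: "G \<in> C00_left T" and S: "continuous_on {0..T} S" and t: "t \<in> {0..T}" and "\<epsilon> > 0"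
  shows "\<exists>\<delta>>0. \<forall>u\<in>{0..<t}. t - \<delta> < u \<longrightarrow> (\<forall>\<omega>\<in>tube T S u \<delta>. \<bar>G (u, \<omega>) - G (t, stopped T t S)\<bar> < \<epsilon>)"
proof -
  obtain \<delta> where \<delta>: "\<delta> > 0" "\<And>u \<omega>. u \<in> {0..<t} \<Longrightarrow> \<omega> \<in> cadlag_paths T \<Longrightarrow> t - \<delta> < u \<Longrightarrow> stopped T u \<omega> = \<omega> \<Longrightarrow>
    (\<And>s. s\<in>{0..T} \<Longrightarrow> \<bar>stopped T t S s - \<omega> s\<bar> \<le> \<delta>) \<Longrightarrow> \<bar>G (t, stopped T t S) - G (u, \<omega>)\<bar> < \<epsilon>"
    using C00_left_left_continuous[OF G t stopped_continuous_cadlag[OF S t] _ assms(4)] t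
    by (auto simp: stopped_stopped)
  have "uniformly_continuous_on {0..T} S"
    by (rule compact_uniformly_continuous[OF S]) simp
  then obtain \<eta> where \<eta>: "\<eta> > 0" "\<And>x y. x \<in> {0..T} \<Longrightarrow> y \<in> {0..T} \<Longrightarrow> \<bar>y - x\<bar> < \<eta> \<Longrightarrow> \<bar>S y - S x\<bar> < \<delta> / 2"
    using \<delta>(1) unfolding uniformly_continuous_on_def dist_real_def by (metis half_gt_zero)
  show ?thesis
  proof (intro exI[of _ "min (\<delta> / 2) \<eta>"] conjI ballI impI)
    fix u \<omega> assume u: "u \<in> {0..<t}" "t - min (\<delta> / 2) \<eta> < u" and \<omega>: "\<omega> \<in> tube T S u (min (\<delta> / 2) \<eta>)"
    have "\<bar>stopped T t S s - \<omega> s\<bar> \<le> \<delta>" if s: "s \<in> {0..T}" for s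
    proof -
      have "\<bar>min s t - min s u\<bar> < \<eta>" using u by auto
      then have "\<bar>S (min s t) - S (min s u)\<bar> < \<delta> / 2" using s u t by (intro \<eta>(2)) auto
      moreover have "\<bar>\<omega> s - S (min s u)\<bar> \<le> \<delta> / 2" using \<omega> s by (auto simp: tube_def)
      ultimately have "\<bar>S (min s t) - \<omega> s\<bar> \<le> \<delta>" by linarith
      then show ?thesis using s by (simp add: stopped_apply)
    qed
    then have "\<bar>G (t, stopped T t S) - G (u, \<omega>)\<bar> < \<epsilon>"
      using u \<omega> \<delta>(1) by (intro \<delta>(2)) (auto simp: tube_def)
    then show "\<bar>G (u, \<omega>) - G (t, stopped T t S)\<bar> < \<epsilon>" by (simp add: abs_minus_commute)
  qed (use \<delta> \<eta> in auto)
qed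

lemma tube_bounded:
  assumes G: "G \<in> C00_left T" "G \<in> bounded_functionals T" and S: "continuous_on {0..T} S" and t: "t \<in> {0<..T}"
  shows "\<exists>C \<delta>. \<delta> > 0 \<and> (\<forall>u\<in>{0..<t}. \<forall>\<omega>\<in>tube T S u \<delta>. \<bar>G (u, \<omega>)\<bar> \<le> C)"
proof -
  obtain \<delta> where \<delta>: "\<delta> > 0" "\<And>u \<omega>. u \<in> {0..<t} \<Longrightarrow> t - \<delta> < u \<Longrightarrow> \<omega>\<in>tube T S u \<delta> \<Longrightarrow> \<bar>G (u, \<omega>) - G (t, stopped T t S)\<bar> < 1"
    using tube_left_continuous[OF G(1) S, of t 1] t by auto
  have "bounded (S ` {0..T})" by (intro compact_imp_bounded compact_continuous_image S) auto
  then obtain K where K: "K > 0" "\<And>s. s \<in> {0..T} \<Longrightarrow> \<bar>S s\<bar> \<le> K"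
    unfolding bounded_pos by auto
  \<comment> \<open>Times up to \<open>t0\<close> < T are covered by
    \<open>bounded_functionals T\<close>, later ones by the left neighbourhood of t. The level K + 1
    below comes from capping the tube radius at 1.\<close>
  define t0 where "t0 = max 0 (t - \<delta>)"
  have t0: "t0 \<in> {0..<T}" using t \<delta>(1) by (auto simp: t0_def)
  have "\<exists>C>0. \<forall>t\<in>{0..t0}. \<forall>\<omega>\<in>cadlag_paths T.
       (SUP s\<in>{0..t}. \<bar>\<omega> s\<bar>) \<le> K + 1 \<longrightarrow> \<bar>G (t, stopped T t \<omega>)\<bar> \<le> C"
  proof -
    have "\<forall>t\<^sub>0\<in>{0..<T}. \<forall>K>0. \<exists>C>0. \<forall>t\<in>{0..t\<^sub>0}. \<forall>\<omega>\<in>cadlag_paths T.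
       (SUP s\<in>{0..t}. \<bar>\<omega> s\<bar>) \<le> K \<longrightarrow> \<bar>G (t, stopped T t \<omega>)\<bar> \<le> C"
      using G(2) by (simp add: bounded_functionals_def)
    then have *: "\<forall>K>0. \<exists>C>0. \<forall>t\<in>{0..t0}. \<forall>\<omega>\<in>cadlag_paths T.
       (SUP s\<in>{0..t}. \<bar>\<omega> s\<bar>) \<le> K \<longrightarrow> \<bar>G (t, stopped T t \<omega>)\<bar> \<le> C"
      using t0 by (rule bspec)
    show ?thesis by (rule mp[OF spec[OF *, of "K + 1"]]) (use K(1) in linarith)
  qed
  then obtain C where C: "\<forall>t\<in>{0..t0}. \<forall>\<omega>\<in>cadlag_paths T.
       (SUP s\<in>{0..t}. \<bar>\<omega> s\<bar>) \<le> K + 1 \<longrightarrow> \<bar>G (t, stopped T t \<omega>)\<bar> \<le> C"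
    by blast
  show ?thesis
  proof (rule exI[of _ "max C (\<bar>G (t, stopped T t S)\<bar> + 1)"], rule exI[of _ "min \<delta> 1"], intro conjI ballI)
    fix u \<omega> assume u: "u \<in> {0..<t}" and \<omega>: "\<omega> \<in> tube T S u (min \<delta> 1)"
    show "\<bar>G (u, \<omega>)\<bar> \<le> max C (\<bar>G (t, stopped T t S)\<bar> + 1)"
    proof (cases "t - \<delta> < u")
      case True
      have "\<omega> \<in> tube T S u \<delta>" using \<omega> tube_mono[of "min \<delta> 1" \<delta>] by auto
      then show ?thesis using \<delta>(2)[OF u True] by fastforce
    next
      case False
      have "(SUP s\<in>{0..u}. \<bar>\<omega> s\<bar>) \<le> K + 1"
      proof (rule cSUP_least)
        fix s assume s: "s \<in> {0..u}"
        then have "s \<in> {0..T}" using t u by auto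
        then have "\<bar>\<omega> s - S (min s u)\<bar> \<le> min \<delta> 1" using \<omega> unfolding tube_def by blast
        moreover have "\<bar>S (min s u)\<bar> \<le> K" using s t u by (intro K(2)) auto
        ultimately show "\<bar>\<omega> s\<bar> \<le> K + 1" by linarith
      qed (use u in auto)
      moreover have "\<omega> \<in> cadlag_paths T" "stopped T u \<omega> = \<omega>" "u \<in> {0..t0}"
        using False u \<omega> by (auto simp: t0_def tube_def)
      ultimately have "\<bar>G (u, \<omega>)\<bar> \<le> C" using C[rule_format, of u \<omega>] by simp
      then show ?thesis by linarith
    qed
  qed (use \<delta> in auto)
qed

text \<open>Jumps at the same time add up, so the right vertical derivative at the path bumped by x
  is the right derivative at x of the real function \<open>q k\<close>, for every real x. Continuity
  in sup norm makes each \<open>q k\<close> continuous, hence these are true derivatives, and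
  Taylor's formula applies to h of either sign.\<close>

lemma vertical_taylor:
  assumes vd: "\<And>k. k < p \<Longrightarrow> vertically_differentiable T ((vderiv T ^^ k) F)"
    and cont: "\<And>k. k \<le> p \<Longrightarrow> (vderiv T ^^ k) F \<in> C00_left T"
    and u: "u \<in> {0..T}" and \<omega>: "\<omega> \<in> cadlag_paths T" "stopped T u \<omega> = \<omega>"
  shows "\<exists>\<theta>. \<bar>\<theta>\<bar> \<le> \<bar>h\<bar> \<and> F (u, bumped T u h \<omega>) =
    (\<Sum>k<p. (vderiv T ^^ k) F (u, \<omega>) / fact k * h ^ k) + (vderiv T ^^ p) F (u, bumped T u \<theta> \<omega>) / fact p * h ^ p"
proof -
  define q where "q k x = (vderiv T ^^ k) F (u, bumped T u x \<omega>)" for k x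
  have cad: "bumped T u x \<omega> \<in> cadlag_paths T" "stopped T u (bumped T u x \<omega>) = bumped T u x \<omega>" for x
    using bumped_cadlag stopped_bumped \<omega> u by auto
  have q_cont: "continuous_on UNIV (q k)" if kp: "k \<le> p" for k
    unfolding continuous_on_iff
  proof (intro ballI allI impI)
    fix x e :: real assume "e > 0"
    then obtain \<delta> where \<delta>: "\<delta> > 0" "\<forall>\<omega>'\<in>cadlag_paths T. stopped T u \<omega>' = \<omega>' \<longrightarrow>
      (\<forall>s\<in>{0..T}. \<bar>bumped T u x \<omega> s - \<omega>' s\<bar> \<le> \<delta>) \<longrightarrow>
        \<bar>(vderiv T ^^ k) F (u, bumped T u x \<omega>) - (vderiv T ^^ k) F (u, \<omega>')\<bar> < e"
      using C00_left_continuous[OF cont[OF kp] u cad] by blast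
    have "\<bar>q k x - q k y\<bar> < e" if "\<bar>y - x\<bar> < \<delta>" for y
    proof -
      have "\<bar>bumped T u x \<omega> s - bumped T u y \<omega> s\<bar> \<le> \<delta>" if "s \<in> {0..T}" for s
        using that \<open>\<bar>y - x\<bar> < \<delta>\<close> \<delta>(1) \<omega> by (auto simp: bumped_apply indicator_def)
      then show ?thesis using \<delta>(2) cad unfolding q_def by blast
    qed
    then show "\<exists>d>0. \<forall>x'\<in>UNIV. dist x' x < d \<longrightarrow> dist (q k x') (q k x) < e"
      using \<delta>(1) by (auto simp: dist_real_def abs_minus_commute)
  qed
  have q_deriv: "((\<lambda>h. (q k (x + h) - q k x) / h) \<longlongrightarrow> q (Suc k) x) (at_right 0)" if kp: "k < p" for k x
  proof -
    have "(u, bumped T u x \<omega>) \<in> Lambda T"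
      using stopped_in_Lambda[OF u cad(1)] cad(2) by simp
    then obtain l where l: "(vquotient T ((vderiv T ^^ k) F) u (bumped T u x \<omega>) \<longlongrightarrow> l) (at_right 0)"
      using vd[OF kp] unfolding vertically_differentiable_def by (auto dest: bspec)
    then have "q (Suc k) x = l"
      by (simp add: q_def vderiv_def tendsto_Lim)
    moreover have "vquotient T ((vderiv T ^^ k) F) u (bumped T u x \<omega>) = (\<lambda>h. (q k (x + h) - q k x) / h)"
      by (auto simp: vquotient_def q_def cad bumped_bumped[OF \<omega>(2) u] fun_eq_iff)
    ultimately show ?thesis using l by simp
  qed
  have "DERIV (q k) x :> q (Suc k) x" if "k < p" for k x
    using that q_cont q_deriv
    by (intro continuous_right_derivative_imp_DERIV) (auto simp: continuous_on_eq_continuous_at)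
  then have "\<exists>\<theta>. \<bar>\<theta>\<bar> \<le> \<bar>h\<bar> \<and> q 0 h = (\<Sum>m<p. q m 0 / fact m * h ^ m) + q p \<theta> / fact p * h ^ p"
    by (intro Maclaurin_bi_le) auto
  then show ?thesis by (simp add: q_def bumped_0 \<omega>)
qed

text \<open>For a frozen path, F is continuous in time although only left-continuity is assumed:
  existence of a finite right derivative gives continuity from the right. The integral formula for
  right derivatives then applies.\<close>

lemma horizontal_integral:
  assumes hd: "horizontally_differentiable T F" and cont: "F \<in> C00_left T"
    and ab: "0 \<le> a" "a < b" "b \<le> T" and \<omega>: "\<omega> \<in> cadlag_paths T" "stopped T a \<omega> = \<omega>"
    and bound: "\<And>u. u \<in> {a..<b} \<Longrightarrow> \<bar>hderiv T F (u, \<omega>)\<bar> \<le> C"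
  shows "set_integrable lborel {a..<b} (\<lambda>u. hderiv T F (u, \<omega>))"
    "(LINT u:{a..<b}|lborel. hderiv T F (u, \<omega>)) = F (b, \<omega>) - F (a, \<omega>)"
proof -
  have stop: "stopped T u \<omega> = \<omega>" if "u \<in> {a..b}" for u
  proof -
    have "stopped T u (stopped T a \<omega>) = stopped T (min u a) \<omega>"
      by (rule stopped_stopped) (use that ab in auto)
    moreover have "min u a = a" using that by simp
    ultimately show ?thesis by (simp only: \<omega>(2))
  qed
  have Lam: "(u, \<omega>) \<in> Lambda T" if "u \<in> {a..b}" for u
    using stopped_in_Lambda[of u T \<omega>] stop[OF that] that ab \<omega> by simp
  have deriv: "((\<lambda>h. (F (u + h, \<omega>) - F (u, \<omega>)) / h) \<longlongrightarrow> hderiv T F (u, \<omega>)) (at_right 0)"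
    if u: "u \<in> {a..<b}" for u
  proof -
    have uT: "u < T" using u ab by auto
    have "(u, \<omega>) \<in> Lambda T" using Lam u by simp
    then obtain l where l: "(hquotient T F u \<omega> \<longlongrightarrow> l) (at_right 0)"
      using bspec[OF hd[unfolded horizontally_differentiable_def], of "(u, \<omega>)"] uT by auto
    then have "hderiv T F (u, \<omega>) = l" using uT by (simp add: hderiv_def tendsto_Lim)
    moreover have "hquotient T F u \<omega> = (\<lambda>h. (F (u + h, \<omega>) - F (u, \<omega>)) / h)"
      using stop u by (auto simp: hquotient_def)
    ultimately show ?thesis using l by simp
  qed
  have right: "((\<lambda>u. F (u, \<omega>)) \<longlongrightarrow> F (u, \<omega>)) (at_right u)" if u: "u \<in> {a..<b}" for u
  proof -
    have "((\<lambda>h. F (u, \<omega>) + h * ((F (u + h, \<omega>) - F (u, \<omega>)) / h)) \<longlongrightarrow> F (u, \<omega>) + 0 * hderiv T F (u, \<omega>)) (at_right 0)"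
      by (intro tendsto_intros deriv[OF u])
    then have "((\<lambda>h. F (u, \<omega>) + h * ((F (u + h, \<omega>) - F (u, \<omega>)) / h)) \<longlongrightarrow> F (u, \<omega>)) (at_right 0)"
      by simp
    moreover have "eventually (\<lambda>h. F (u, \<omega>) + h * ((F (u + h, \<omega>) - F (u, \<omega>)) / h) = F (h + u, \<omega>)) (at_right 0)"
      by (rule eventually_at_rightI[of 0 1]) (auto simp: add.commute)
    ultimately show ?thesis
      unfolding filterlim_at_right_to_0[of _ _ u] by (rule Lim_transform_eventually)
  qed
  have left: "((\<lambda>u. F (u, \<omega>)) \<longlongrightarrow> F (u, \<omega>)) (at_left u)" if u: "u \<in> {a<..b}" for u
  proof (rule tendstoI)
    fix e :: real assume "e > 0"
    have "u \<in> {0..T}" using u ab by auto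
    moreover have "stopped T u \<omega> = \<omega>" using stop u by simp
    ultimately obtain \<delta> where \<delta>: "\<delta> > 0" "\<forall>v\<in>{0..<u}. \<forall>\<omega>'\<in>cadlag_paths T. u - \<delta> < v \<longrightarrow> stopped T v \<omega>' = \<omega>' \<longrightarrow>
        (\<forall>s\<in>{0..T}. \<bar>\<omega> s - \<omega>' s\<bar> \<le> \<delta>) \<longrightarrow> \<bar>F (u, \<omega>) - F (v, \<omega>')\<bar> < e"
      using C00_left_left_continuous[OF cont _ \<omega>(1) _ \<open>e > 0\<close>] by blast
    show "eventually (\<lambda>v. dist (F (v, \<omega>)) (F (u, \<omega>)) < e) (at_left u)"
    proof (rule eventually_at_leftI[of "max a (u - \<delta>)"])
      fix v assume v: "v \<in> {max a (u - \<delta>)<..<u}"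
      then have "v \<in> {0..<u}" "u - \<delta> < v" "stopped T v \<omega> = \<omega>" using u ab by (auto intro: stop)
      then have "\<bar>F (u, \<omega>) - F (v, \<omega>)\<bar> < e"
        by (intro \<delta>(2)[rule_format] \<omega>(1)) (use \<delta>(1) in auto)
      then show "dist (F (v, \<omega>)) (F (u, \<omega>)) < e" by (simp add: dist_real_def abs_minus_commute)
    qed (use \<delta> u in auto)
  qed
  have "continuous_on {a..b} (\<lambda>u. F (u, \<omega>))"
  proof (rule continuous_on_IccI)
    show "((\<lambda>u. F (u, \<omega>)) \<longlongrightarrow> F (u, \<omega>)) (at u)" if "a < u" "u < b" for u
      unfolding filterlim_at_split using left right that by simp
  qed (use ab left right in simp_all)
  note * = right_derivative_integral[OF less_imp_le[OF ab(2)] this deriv bound]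
  show "set_integrable lborel {a..<b} (\<lambda>u. hderiv T F (u, \<omega>))"
    "(LINT u:{a..<b}|lborel. hderiv T F (u, \<omega>)) = F (b, \<omega>) - F (a, \<omega>)"
    using * by auto
qed

section \<open>Step paths along a partition\<close>

text \<open>For j > 0 this is the piecewise constant approximation stopped just before t_j, written
  recursively so that passing from j to j+1 changes the path only from t_j on. Index 0 is the
  constant S(0), which makes the telescope start at the value of F for S_0.\<close>

primrec step_path :: "real \<Rightarrow> real list \<Rightarrow> (real \<Rightarrow> real) \<Rightarrow> nat \<Rightarrow> real \<Rightarrow> real" where
  "step_path T P S 0 = (\<lambda>s\<in>{0..T}. S 0)"
| "step_path T P S (Suc j) =
    (\<lambda>s\<in>{0..T}. if s < P ! j then step_path T P S j s else S (P ! Suc j))"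

lemma abs_increment_le_osc:
  assumes P: "is_partition T P" and S: "continuous_on {0..T} S" and j: "j < num_intervals P"
    and ab: "a \<in> {P ! j..P ! Suc j}" "b \<in> {P ! j..P ! Suc j}"
  shows "\<bar>S b - S a\<bar> \<le> osc S P"
proof -
  let ?I = "\<lambda>j. {P ! j..P ! Suc j} \<times> {P ! j..P ! Suc j}"
  have sub: "{P ! j..P ! Suc j} \<subseteq> {0..T}"
    using partition_nth_mem[OF P, of j] partition_nth_mem[OF P, of "Suc j"] j by auto
  have "bounded (S ` {0..T})" by (intro compact_imp_bounded compact_continuous_image S) auto
  then obtain K where "\<forall>y\<in>S ` {0..T}. norm y \<le> K" unfolding bounded_iff by blast
  then have K: "\<bar>S s\<bar> \<le> K" if "s \<in> {0..T}" for s using that by auto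
  have "bdd_above ((\<lambda>(r, s). \<bar>S s - S r\<bar>) ` ?I j)"
  proof (rule bdd_aboveI2[where M = "2 * K"])
    fix z assume "z \<in> ?I j"
    then obtain r s where "z = (r, s)" "r \<in> {0..T}" "s \<in> {0..T}" using sub by blast
    then show "(case z of (r, s) \<Rightarrow> \<bar>S s - S r\<bar>) \<le> 2 * K" using K[of r] K[of s] by auto
  qed
  then have "\<bar>S b - S a\<bar> \<le> (SUP (r, s)\<in>?I j. \<bar>S s - S r\<bar>)"
    by (rule cSUP_upper2[where x = "(a, b)"]) (use ab in auto)
  also have "\<dots> \<le> osc S P"
    unfolding osc_def using j by (intro Max_ge) auto
  finally show ?thesis .
qed

lemma partition_step_le_mesh:
  "j < num_intervals P \<Longrightarrow> P ! Suc j - P ! j \<le> mesh P"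
  unfolding mesh_def by (intro Max_ge) auto

lemma osc_nonneg:
  assumes "is_partition T P" "continuous_on {0..T} S" "0 < T"
  shows "0 \<le> osc S P"
  using abs_increment_le_osc[OF assms(1,2) partition_num_intervals_pos[OF assms(1,3)], of "P ! 0" "P ! 0"]
    partition_nth_less[OF assms(1), of 0 1] partition_num_intervals_pos[OF assms(1,3)] by simp

lemma partition_interval_exists:
  assumes "is_partition T P" "j \<le> num_intervals P" "0 \<le> s" "s < P ! j"
  obtains l where "l < j" "P ! l \<le> s" "s < P ! Suc l"
proof -
  have "\<exists>l<j. P ! l \<le> s \<and> s < P ! Suc l"
    using assms(2,4)
  proof (induction j)
    case 0
    then show ?case using assms(1,3) by (simp add: partition_nth_0)
  next
    case (Suc j)
    then show ?case by (cases "s < P ! j") (auto intro: less_SucI)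
  qed
  then show ?thesis using that by blast
qed

lemma step_path_after:
  assumes "is_partition T P" "j \<le> num_intervals P" "s \<in> {0..T}" "P ! j \<le> s"
  shows "step_path T P S j s = S (P ! j)"
proof (cases j)
  case 0
  then show ?thesis using assms by (simp add: partition_nth_0)
next
  case (Suc i)
  then have "P ! i < P ! j" using assms by (intro partition_nth_less) auto
  then show ?thesis using assms Suc by auto
qed

lemma step_path_before:
  assumes "is_partition T P" "j \<le> num_intervals P" "s \<in> {0..T}" "l < j" "P ! l \<le> s" "s < P ! Suc l"
  shows "step_path T P S j s = S (P ! Suc l)"
  using assms(2,4)
proof (induction j)
  case (Suc j)
  show ?case
  proof (cases "l = j")
    case True
    then show ?thesis using assms(3,5) by simp
  next
    case False
    then have "P ! Suc l \<le> P ! j" using Suc.prems by (intro partition_nth_mono[OF assms(1)]) auto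
    then show ?thesis using False Suc assms(3,6) by auto
  qed
qed simp

text \<open>The path with index j is constant from t_(j-1) on, not merely from t_j. Hence the path
  with index j+1 is already stopped at t_j and can be carried horizontally to t_(j+1). For j = 0 the
  truncated subtraction gives the node 0.\<close>

lemma stopped_step_path:
  assumes P: "is_partition T P" and "j \<le> num_intervals P" "u \<in> {P ! (j - 1)..T}"
  shows "stopped T u (step_path T P S j) = step_path T P S j"
proof (cases j)
  case 0
  then show ?thesis using assms by (auto simp: stopped_def fun_eq_iff partition_nth_0)
next
  case (Suc i)
  have "0 \<le> P ! i" using partition_nth_mem[OF P, of i] assms Suc by simp
  then show ?thesis using assms Suc by (auto simp: stopped_def fun_eq_iff min_def)
qed

lemma stopped_step_path_nth:
  assumes P: "is_partition T P" and j: "j \<le> num_intervals P"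
  shows "stopped T (P ! j) (step_path T P S j) = step_path T P S j"
  using partition_nth_mono[OF P, of "j - 1" j] partition_nth_mem[OF P j] j
  by (intro stopped_step_path P) auto

lemma step_path_Suc_eq_bumped:
  assumes P: "is_partition T P" and j: "j < num_intervals P"
  shows "step_path T P S (Suc j) = bumped T (P ! j) (S (P ! Suc j) - S (P ! j)) (step_path T P S j)"
proof
  fix s
  show "step_path T P S (Suc j) s = bumped T (P ! j) (S (P ! Suc j) - S (P ! j)) (step_path T P S j) s"
  proof (cases "s \<in> {0..T}")
    case True
    then show ?thesis
      using step_path_after[OF P _ True, of j S] j
      by (subst bumped_apply[OF stopped_step_path_nth[OF P]]) auto
  qed (auto simp: bumped_def)
qed

lemma step_path_cadlag:
  assumes P: "is_partition T P" and j: "j \<le> num_intervals P"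
  shows "step_path T P S j \<in> cadlag_paths T"
  using j
proof (induction j)
  case 0
  show ?case by (intro continuous_imp_cadlag) (auto simp: extensional_def intro: continuous_on_eq[OF continuous_on_const])
next
  case (Suc j)
  then show ?case
    unfolding step_path_Suc_eq_bumped[OF P Suc_le_lessD[OF Suc.prems]]
    by (intro bumped_cadlag stopped_step_path_nth P) auto
qed

text \<open>At each time the step path takes the value of \<open>S\<close> at the right end of the
  current cell, or of cell j after that cell. The time of comparison, cut off at u, lies in that
  same cell, so the difference is an increment inside one cell.\<close>

lemma step_path_Suc_in_tube:
  assumes P: "is_partition T P" and S: "continuous_on {0..T} S" and j: "j < num_intervals P"
    and u: "u \<in> {P ! j..P ! Suc j}"
  shows "step_path T P S (Suc j) \<in> tube T S u (osc S P)"
proof -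
  have mem: "P ! j \<in> {0..T}" "P ! Suc j \<in> {0..T}" using partition_nth_mem[OF P] j by auto
  have "\<bar>step_path T P S (Suc j) s - S (min s u)\<bar> \<le> osc S P" if s: "s \<in> {0..T}" for s
  proof (cases "s < P ! j")
    case True
    then obtain l where l: "l < j" "P ! l \<le> s" "s < P ! Suc l"
      using partition_interval_exists[OF P, of j s] j s by auto
    then have "step_path T P S (Suc j) s = S (P ! Suc l)"
      using j s by (intro step_path_before[OF P]) auto
    moreover have "min s u = s" using True u by auto
    moreover have "\<bar>S (P ! Suc l) - S s\<bar> \<le> osc S P"
      using l j by (intro abs_increment_le_osc[OF P S, of l]) auto
    ultimately show ?thesis by simp
  next
    case False
    then have "step_path T P S (Suc j) s = S (P ! Suc j)" using s by simp
    moreover have "\<bar>S (P ! Suc j) - S (min s u)\<bar> \<le> osc S P"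
      using False u by (intro abs_increment_le_osc[OF P S j]) auto
    ultimately show ?thesis by simp
  qed
  moreover have "stopped T u (step_path T P S (Suc j)) = step_path T P S (Suc j)"
    using u mem j by (intro stopped_step_path P) auto
  ultimately show ?thesis
    using step_path_cadlag[OF P, of "Suc j" S] j by (simp add: tube_def del: step_path.simps)
qed

lemma step_path_in_tube:
  assumes P: "is_partition T P" and S: "continuous_on {0..T} S" and T: "0 < T" and j: "j \<le> num_intervals P"
  shows "step_path T P S j \<in> tube T S (P ! j) (osc S P)"
proof (cases j)
  case 0
  then show ?thesis
    using osc_nonneg[OF P S T] step_path_cadlag[OF P j, of S] stopped_step_path_nth[OF P j, of S] P
    by (auto simp: tube_def partition_nth_0)
next
  case (Suc i)
  then show ?thesis
    using step_path_Suc_in_tube[OF P S, of i "P ! Suc i"] partition_nth_less[OF P, of i "Suc i"] j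
    by (auto simp del: step_path.simps)
qed

text \<open>One oscillation accounts for the step path and one for the intermediate jump of Taylor's
  remainder. This is the source of the factor 2 in the later conditions on
  \<open>osc\<close>.\<close>

lemma bumped_step_path_in_tube:
  assumes P: "is_partition T P" and S: "continuous_on {0..T} S" and T: "0 < T" and j: "j < num_intervals P"
    and \<theta>: "\<bar>\<theta>\<bar> \<le> \<bar>S (P ! Suc j) - S (P ! j)\<bar>"
  shows "bumped T (P ! j) \<theta> (step_path T P S j) \<in> tube T S (P ! j) (2 * osc S P)"
proof -
  have j': "j \<le> num_intervals P" using j by simp
  have Z: "step_path T P S j \<in> tube T S (P ! j) (osc S P)" by (rule step_path_in_tube[OF P S T j'])
  have "\<bar>S (P ! Suc j) - S (P ! j)\<bar> \<le> osc S P"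
    using partition_nth_less[OF P, of j "Suc j"] j by (intro abs_increment_le_osc[OF P S j]) auto
  then have \<theta>': "\<bar>\<theta>\<bar> \<le> osc S P" using \<theta> by linarith
  have "\<bar>bumped T (P ! j) \<theta> (step_path T P S j) s - S (min s (P ! j))\<bar> \<le> 2 * osc S P" if s: "s \<in> {0..T}" for s
  proof -
    have "\<bar>step_path T P S j s - S (min s (P ! j))\<bar> \<le> osc S P" using Z s by (simp add: tube_def)
    moreover have "\<bar>\<theta> * indicator {P ! j..} s\<bar> \<le> osc S P"
      using \<theta>' by (auto simp: indicator_def)
    ultimately show ?thesis
      unfolding bumped_apply[OF stopped_step_path_nth[OF P j'] s] by linarith
  qed
  then show ?thesis
    using bumped_cadlag[OF stopped_step_path_nth[OF P j'] step_path_cadlag[OF P j']]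
      stopped_bumped[OF stopped_step_path_nth[OF P j'] partition_nth_mem[OF P j']]
    by (simp add: tube_def)
qed

lemma sum_indicator_partition:
  fixes h :: "nat \<Rightarrow> real"
  assumes P: "is_partition T P" and l: "l < M" and M: "M \<le> num_intervals P"
    and s: "P ! l \<le> s" "s < P ! Suc l"
  shows "(\<Sum>j<M. indicator {P ! j..<P ! Suc j} s * h j) = h l"
proof -
  have "indicator {P ! j..<P ! Suc j} s = (if j = l then 1 else (0::real))" if j: "j < M" for j
  proof -
    have "\<not> (P ! j \<le> s \<and> s < P ! Suc j)" if "j < l"
      using partition_nth_mono[OF P, of "Suc j" l] that l M s by auto
    moreover have "\<not> (P ! j \<le> s \<and> s < P ! Suc j)" if "l < j"
      using partition_nth_mono[OF P, of "Suc l" j] that j M s by auto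
    ultimately show ?thesis using s by (cases j l rule: linorder_cases) (auto simp: indicator_def)
  qed
  then have "(\<Sum>j<M. indicator {P ! j..<P ! Suc j} s * h j) = (\<Sum>j<M. if j = l then h j else 0)"
    by (intro sum.cong) auto
  then show ?thesis using l by simp
qed

lemma pc_approx_eq:
  assumes P: "is_partition T P" and l: "l < num_intervals P" and s: "P ! l \<le> s" "s < P ! Suc l"
  shows "pc_approx T P S s = S (P ! Suc l)"
proof -
  have "(\<Sum>j<num_intervals P. S (P ! Suc j) * indicator {P ! j..<P ! Suc j} s) = S (P ! Suc l)"
    using sum_indicator_partition[OF P l _ s, of "\<lambda>j. S (P ! Suc j)"]
    by (simp add: mult.commute)
  then show ?thesis
    using partition_nth_mem[OF P, of "Suc l"] l s by (simp add: pc_approx_def)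
qed

text \<open>The index is \<open>max 1 j\<close> because \<open>\<omega>\<close> stopped at \<open>0-\<close> is \<open>\<omega>\<close> stopped at \<open>0\<close> by convention and the
  approximation already equals \<open>S t\<^sub>1\<close> at time \<open>0\<close>.\<close>

lemma stopped_left_pc_approx:
  assumes P: "is_partition T P" and j: "j < num_intervals P"
  shows "stopped_left T (P ! j) (pc_approx T P S) = step_path T P S (max 1 j)"
proof (cases j)
  case 0
  have "pc_approx T P S 0 = S (P ! Suc 0)"
    using pc_approx_eq[OF P, of 0 0] partition_nth_less[OF P, of 0 1] j 0 by (simp add: partition_nth_0[OF P])
  then show ?thesis
    using 0 P by (auto simp: stopped_left_def stopped_def partition_nth_0 fun_eq_iff min_def)
next
  case (Suc i)
  have less: "P ! i < P ! j" using Suc j by (intro partition_nth_less[OF P]) auto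
  have pos: "0 < P ! j" using less partition_nth_mem[OF P, of i] Suc j by auto
  have "eventually (\<lambda>s. pc_approx T P S s = S (P ! j)) (at_left (P ! j))"
    using less pc_approx_eq[OF P, of i] Suc j by (intro eventually_at_leftI[of "P ! i"]) auto
  then have lim: "Lim (at_left (P ! j)) (pc_approx T P S) = S (P ! j)"
    by (intro tendsto_Lim tendsto_eventually) auto
  have "stopped_left T (P ! j) (pc_approx T P S) s = step_path T P S j s" for s
  proof (cases "s \<in> {0..T}")
    case True
    show ?thesis
    proof (cases "s < P ! j")
      case below: True
      then obtain l where l: "l < j" "P ! l \<le> s" "s < P ! Suc l"
        using partition_interval_exists[OF P, of j s] j True by auto
      have "step_path T P S j s = S (P ! Suc l)"
        using l j True by (intro step_path_before[OF P]) auto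
      moreover have "pc_approx T P S s = S (P ! Suc l)"
        using l j by (intro pc_approx_eq[OF P]) auto
      ultimately show ?thesis using True below pos by (simp add: stopped_left_def)
    next
      case False
      then show ?thesis
        using True pos lim j step_path_after[OF P _ True, of j S] by (simp add: stopped_left_def)
    qed
  next
    case False
    then show ?thesis using Suc pos by (auto simp: stopped_left_def)
  qed
  then show ?thesis using Suc by (simp add: max_def fun_eq_iff del: step_path.simps)
qed

section \<open>Convergence along the partitions\<close>

lemma path_functional_left_continuous:
  assumes G: "G \<in> C00_left T" and S: "continuous_on {0..T} S" and u: "u \<in> {0..T}"
  shows "((\<lambda>s. G (s, stopped T s S)) \<longlongrightarrow> G (u, stopped T u S)) (at u within {0..<u})"
proof (rule tendstoI)
  fix e :: real assume "e > 0"
  then obtain \<delta> where \<delta>: "\<delta> > 0" "\<forall>v\<in>{0..<u}. u - \<delta> < v \<longrightarrow>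
      (\<forall>\<omega>\<in>tube T S v \<delta>. \<bar>G (v, \<omega>) - G (u, stopped T u S)\<bar> < e)"
    using tube_left_continuous[OF G S u] by blast
  show "eventually (\<lambda>s. dist (G (s, stopped T s S)) (G (u, stopped T u S)) < e) (at u within {0..<u})"
    unfolding eventually_at dist_real_def
  proof (intro exI[of _ \<delta>] conjI ballI impI)
    fix s assume "s \<in> {0..<u}" and "s \<noteq> u \<and> \<bar>s - u\<bar> < \<delta>"
    moreover from this have "stopped T s S \<in> tube T S s \<delta>"
      using \<delta>(1) u by (intro stopped_in_tube[OF S]) auto
    ultimately show "\<bar>G (s, stopped T s S) - G (u, stopped T u S)\<bar> < e"
      using \<delta>(2) by (auto dest: bspec)
  qed (rule \<delta>)
qed

lemma path_functional_measurable:
  assumes G: "G \<in> C00_left T" and S: "continuous_on {0..T} S" and t: "t \<le> T"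
  shows "(\<lambda>s. G (s, stopped T s S) * indicator {0..t} s) \<in> borel_measurable borel"
proof -
  have "(\<lambda>s. G (s, stopped T s S)) \<in> borel_measurable (restrict_space borel {0..t})"
    using t by (intro borel_measurable_left_continuous path_functional_left_continuous[OF G S]) auto
  then show ?thesis
    by (subst (asm) borel_measurable_restrict_space_iff) (auto simp: mult.commute)
qed

lemma path_functional_bounded:
  assumes G: "G \<in> C00_left T" "G \<in> bounded_functionals T" and S: "continuous_on {0..T} S" and t: "t \<in> {0<..T}"
  shows "\<exists>C. \<forall>u\<in>{0..t}. \<bar>G (u, stopped T u S)\<bar> \<le> C"
proof -
  obtain C \<delta> where C: "\<delta> > 0" "\<forall>u\<in>{0..<t}. \<forall>\<omega>\<in>tube T S u \<delta>. \<bar>G (u, \<omega>)\<bar> \<le> C"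
    using tube_bounded[OF G S t] by blast
  have "\<bar>G (u, stopped T u S)\<bar> \<le> max C \<bar>G (t, stopped T t S)\<bar>" if u: "u \<in> {0..t}" for u
  proof (cases "u = t")
    case False
    then have "stopped T u S \<in> tube T S u \<delta>" using u t C(1) by (intro stopped_in_tube[OF S]) auto
    then have "\<bar>G (u, stopped T u S)\<bar> \<le> C" using False u C(2) by auto
    then show ?thesis by linarith
  qed auto
  then show ?thesis by blast
qed

text \<open>The measure is left general so that the same statement serves Lebesgue measure and the
  measure of [S]^p.\<close>

lemma path_functional_set_integrable:
  assumes G: "G \<in> C00_left T" "G \<in> bounded_functionals T" and S: "continuous_on {0..T} S" and t: "t \<in> {0<..T}"
    and M: "sets M = sets borel" "emeasure M {0..t} < \<infinity>"
  shows "set_integrable M {0..t} (\<lambda>s. G (s, stopped T s S))"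
proof -
  obtain C where C: "\<And>u. u \<in> {0..t} \<Longrightarrow> \<bar>G (u, stopped T u S)\<bar> \<le> C"
    using path_functional_bounded[OF G S t] by blast
  have "integrable M (\<lambda>s. G (s, stopped T s S) * indicator {0..t} s)"
  proof (rule Bochner_Integration.integrable_bound)
    show "integrable M (\<lambda>s. C * indicator {0..t} s)"
      using M by (intro integrable_mult_right integrable_real_indicator) auto
    show "(\<lambda>s. G (s, stopped T s S) * indicator {0..t} s) \<in> borel_measurable M"
      using path_functional_measurable[OF G(1) S] t by (simp add: measurable_cong_sets[OF M(1) refl])
    show "AE s in M. norm (G (s, stopped T s S) * indicator {0..t} s) \<le> norm (C * indicator {0..t} s)"
      using C by (auto simp: indicator_def intro!: always_eventually order_trans[OF _ abs_ge_self])
  qed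
  then show ?thesis by (simp add: set_integrable_def mult.commute)
qed

text \<open>Since t > 0, the node 0 lies below t and the set defining \<open>last_index\<close> is
  nonempty; t = 0 is handled apart in the theorem.\<close>

locale functional_along_partitions =
  fixes T :: real and p :: nat and F :: functional
    and \<pi> :: "nat \<Rightarrow> real list" and S :: "real \<Rightarrow> real" and t :: real
  assumes p: "p \<ge> 2" and F: "F \<in> C1p_b T p"
    and part: "\<And>n. is_partition T (\<pi> n)"
    and mesh_lim: "(\<lambda>n. mesh (\<pi> n)) \<longlonglongrightarrow> 0"
    and S: "continuous_on {0..T} S"
    and osc_lim: "(\<lambda>n. osc S (\<pi> n)) \<longlonglongrightarrow> 0"
    and t: "t \<in> {0<..T}"
begin

abbreviation "N n \<equiv> num_intervals (\<pi> n)"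
abbreviation "x n j \<equiv> \<pi> n ! j"
abbreviation "Z n j \<equiv> step_path T (\<pi> n) S j"
abbreviation "\<Delta> n j \<equiv> S (\<pi> n ! Suc j) - S (\<pi> n ! j)"
abbreviation "G k \<equiv> (vderiv T ^^ k) F"
abbreviation "DF \<equiv> hderiv T F"

text \<open>The cell with t_j < t \<le> t_(j+1). The inequality at t_j is strict so that the
  telescope ends before t and its last value tends to t from the left, the side on which F is
  continuous in time.\<close>

definition last_index :: "nat \<Rightarrow> nat" where
  "last_index n = Max {j. j < N n \<and> x n j < t}"

lemma T_pos: "0 < T" using t by auto

lemma G_C00: "k \<le> p \<Longrightarrow> G k \<in> C00_left T"
  and G_bounded: "k \<le> p \<Longrightarrow> G k \<in> bounded_functionals T"
proof -
  assume "k \<le> p"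
  then have "k = 0 \<or> k \<in> {1..p}" by auto
  then have "G k \<in> C00_left T \<inter> bounded_functionals T"
    using F unfolding C1p_b_def by (metis (mono_tags, lifting) mem_Collect_eq funpow_0)
  then show "G k \<in> C00_left T" "G k \<in> bounded_functionals T" by blast+
qed

lemma DF_C00: "DF \<in> C00_left T" and DF_bounded: "DF \<in> bounded_functionals T"
  using F by (auto simp: C1p_b_def)

lemma last_index: "last_index n < N n" "x n (last_index n) < t"
  and less_t_iff: "j < N n \<Longrightarrow> x n j < t \<longleftrightarrow> j \<le> last_index n"
  and t_le: "t \<le> x n (Suc (last_index n))"
proof -
  let ?J = "{j. j < N n \<and> x n j < t}"
  have "0 \<in> ?J"
    using partition_num_intervals_pos[OF part T_pos] t by (simp add: partition_nth_0[OF part])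
  then have "last_index n \<in> ?J" unfolding last_index_def by (intro Max_in) auto
  then show *: "last_index n < N n" "x n (last_index n) < t" by auto
  have max: "j \<le> last_index n" if "j < N n" "x n j < t" for j
    unfolding last_index_def using that by (intro Max_ge) auto
  show "j < N n \<Longrightarrow> x n j < t \<longleftrightarrow> j \<le> last_index n"
    using max[of j] partition_nth_mono[OF part, of j "last_index n" n] * by linarith
  show "t \<le> x n (Suc (last_index n))"
  proof (cases "Suc (last_index n) < N n")
    case True
    then show ?thesis using max[of "Suc (last_index n)"] by (cases "x n (Suc (last_index n)) < t") auto
  next
    case False
    then have "Suc (last_index n) = N n" using * by simp
    then show ?thesis using t partition_nth_last[OF part, of n] by simp
  qed
qed

lemma node_mem: "j \<le> N n \<Longrightarrow> x n j \<in> {0..T}"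
  by (rule partition_nth_mem[OF part])

lemma node_less: "i < j \<Longrightarrow> j \<le> N n \<Longrightarrow> x n i < x n j"
  by (rule partition_nth_less[OF part])

lemma eventually_last_node_gt:
  assumes "s < t"
  shows "eventually (\<lambda>n. s < x n (last_index n)) sequentially"
proof -
  have "eventually (\<lambda>n. mesh (\<pi> n) < t - s) sequentially"
    using assms by (intro order_tendstoD(2)[OF mesh_lim]) auto
  then show ?thesis
  proof eventually_elim
    case (elim n)
    then show ?case
      using partition_step_le_mesh[OF last_index(1), of n] t_le[of n] by linarith
  qed
qed

lemma eventually_osc_le: "0 < \<delta> \<Longrightarrow> eventually (\<lambda>n. 2 * osc S (\<pi> n) \<le> \<delta>) sequentially"
  using order_tendstoD(2)[OF osc_lim, of "\<delta> / 2"] by (auto elim: eventually_mono)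

lemma osc_nonneg': "0 \<le> osc S (\<pi> n)"
  by (rule osc_nonneg[OF part S T_pos])

lemma increment_le_osc: "j < N n \<Longrightarrow> a \<in> {x n j..x n (Suc j)} \<Longrightarrow> b \<in> {x n j..x n (Suc j)} \<Longrightarrow>
    \<bar>S b - S a\<bar> \<le> osc S (\<pi> n)"
  by (rule abs_increment_le_osc[OF part S])

lemma Z_in_tube: "j \<le> N n \<Longrightarrow> 2 * osc S (\<pi> n) \<le> \<delta> \<Longrightarrow> Z n j \<in> tube T S (x n j) \<delta>"
  by (rule subsetD[OF tube_mono step_path_in_tube[OF part S T_pos]]) (use osc_nonneg'[of n] in auto)

lemma Z_Suc_in_tube:
  "j < N n \<Longrightarrow> u \<in> {x n j..x n (Suc j)} \<Longrightarrow> 2 * osc S (\<pi> n) \<le> \<delta> \<Longrightarrow> Z n (Suc j) \<in> tube T S u \<delta>"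
  by (rule subsetD[OF tube_mono step_path_Suc_in_tube[OF part S]]) (use osc_nonneg'[of n] in auto)

section \<open>Limits of the terms in the telescoped change of F\<close>

lemma last_value_tendsto:
  "(\<lambda>n. F (x n (last_index n), Z n (last_index n))) \<longlonglongrightarrow> F (t, stopped T t S)"
proof (rule tendstoI)
  fix e :: real assume e: "e > 0"
  have "t \<in> {0..T}" using t by auto
  then obtain \<delta> where \<delta>: "\<delta> > 0" "\<forall>v\<in>{0..<t}. t - \<delta> < v \<longrightarrow>
      (\<forall>\<omega>\<in>tube T S v \<delta>. \<bar>F (v, \<omega>) - F (t, stopped T t S)\<bar> < e)"
    using tube_left_continuous[OF G_C00[of 0, simplified] S _ e] by blast
  have "eventually (\<lambda>n. t - \<delta> < x n (last_index n)) sequentially"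
    using \<delta>(1) by (intro eventually_last_node_gt) simp
  then show "eventually (\<lambda>n. dist (F (x n (last_index n), Z n (last_index n))) (F (t, stopped T t S)) < e) sequentially"
    using eventually_osc_le[OF \<delta>(1)]
  proof eventually_elim
    case (elim n)
    have "x n (last_index n) \<in> {0..<t}"
      using last_index[of n] node_mem[of "last_index n" n] by auto
    moreover have "Z n (last_index n) \<in> tube T S (x n (last_index n)) \<delta>"
      using last_index(1)[of n] elim by (intro Z_in_tube) auto
    ultimately show ?case using \<delta>(2) elim by (simp add: dist_real_def)
  qed
qed

lemma horizontal_sum_tendsto:
  "(\<lambda>n. \<Sum>j<last_index n. F (x n (Suc j), Z n (Suc j)) - F (x n j, Z n (Suc j)))
    \<longlonglongrightarrow> (LINT s:{0..t}|lborel. DF (s, stopped T s S))"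
proof -
  \<comment> \<open>All horizontal increments are glued into one function of time, turning their sum
    into a single integral.\<close>
  define D where "D n u = (\<Sum>j<last_index n. indicator {x n j..<x n (Suc j)} u * DF (u, Z n (Suc j)))" for n u
  obtain C \<delta> where C: "\<delta> > 0" "\<forall>u\<in>{0..<t}. \<forall>\<omega>\<in>tube T S u \<delta>. \<bar>DF (u, \<omega>)\<bar> \<le> C"
    using tube_bounded[OF DF_C00 DF_bounded S t] by blast
  obtain n0 where n0: "\<And>n. n \<ge> n0 \<Longrightarrow> 2 * osc S (\<pi> n) \<le> \<delta>"
    using eventually_osc_le[OF C(1)] unfolding eventually_sequentially by blast
  have bound: "\<bar>DF (u, Z n (Suc j))\<bar> \<le> C"
    if n: "n \<ge> n0" and j: "j < last_index n" and u: "u \<in> {x n j..<x n (Suc j)}" for n j u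
  proof -
    have jN: "j < N n" using j last_index(1)[of n] by linarith
    have "x n (Suc j) \<le> x n (last_index n)"
      using j last_index(1)[of n] by (intro partition_nth_mono[OF part]) auto
    then have "u \<in> {0..<t}" using u last_index(2)[of n] node_mem[of j n] jN by auto
    moreover have "Z n (Suc j) \<in> tube T S u \<delta>"
      using jN u n0[OF n] by (intro Z_Suc_in_tube) auto
    ultimately show ?thesis using C(2) by blast
  qed
  have int: "set_integrable lborel {x n j..<x n (Suc j)} (\<lambda>u. DF (u, Z n (Suc j)))"
      "(LINT u:{x n j..<x n (Suc j)}|lborel. DF (u, Z n (Suc j))) = F (x n (Suc j), Z n (Suc j)) - F (x n j, Z n (Suc j))"
    if n: "n \<ge> n0" and j: "j < last_index n" for n j
  proof -
    have jN: "j < N n" using j last_index(1)[of n] by linarith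
    have "stopped T (x n j) (Z n (Suc j)) = Z n (Suc j)"
      using jN node_mem[of j n] by (intro stopped_step_path[OF part]) auto
    moreover have "horizontally_differentiable T F" using F by (simp add: C1p_b_def)
    moreover have "0 \<le> x n j" "x n (Suc j) \<le> T" "x n j < x n (Suc j)"
      using node_mem[of j n] node_mem[of "Suc j" n] node_less[of j "Suc j" n] jN by auto
    moreover have "Z n (Suc j) \<in> cadlag_paths T" using jN by (intro step_path_cadlag[OF part]) auto
    ultimately show "set_integrable lborel {x n j..<x n (Suc j)} (\<lambda>u. DF (u, Z n (Suc j)))"
      "(LINT u:{x n j..<x n (Suc j)}|lborel. DF (u, Z n (Suc j))) = F (x n (Suc j), Z n (Suc j)) - F (x n j, Z n (Suc j))"
      using horizontal_integral[of T F "x n j" "x n (Suc j)" "Z n (Suc j)" C] bound[OF n j] G_C00[of 0]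
      by (simp_all del: step_path.simps)
  qed
  have D_int: "integrable lborel (D n)"
    "integral\<^sup>L lborel (D n) = (\<Sum>j<last_index n. F (x n (Suc j), Z n (Suc j)) - F (x n j, Z n (Suc j)))"
    if n: "n \<ge> n0" for n
  proof -
    have int': "integrable lborel (\<lambda>u. indicator {x n j..<x n (Suc j)} u * DF (u, Z n (Suc j)))" if "j < last_index n" for j
      using int(1)[OF n that] by (simp add: set_integrable_def del: step_path.simps)
    show "integrable lborel (D n)"
      unfolding D_def[abs_def] using int' by (intro Bochner_Integration.integrable_sum) auto
    have "integral\<^sup>L lborel (D n) = (\<Sum>j<last_index n. \<integral>u. indicator {x n j..<x n (Suc j)} u * DF (u, Z n (Suc j)) \<partial>lborel)"
      unfolding D_def[abs_def] using int' by (intro Bochner_Integration.integral_sum) auto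
    also have "\<dots> = (\<Sum>j<last_index n. F (x n (Suc j), Z n (Suc j)) - F (x n j, Z n (Suc j)))"
      using int(2)[OF n] by (intro sum.cong) (auto simp: set_lebesgue_integral_def simp del: step_path.simps)
    finally show "integral\<^sup>L lborel (D n) = (\<Sum>j<last_index n. F (x n (Suc j), Z n (Suc j)) - F (x n j, Z n (Suc j)))" .
  qed
  have D_eq: "\<exists>l<last_index n. u \<in> {x n l..<x n (Suc l)} \<and> D n u = DF (u, Z n (Suc l))"
    if u: "0 \<le> u" "u < x n (last_index n)" for n u
  proof -
    obtain l where l: "l < last_index n" "x n l \<le> u" "u < x n (Suc l)"
      using partition_interval_exists[OF part, of "last_index n" n u] u last_index(1)[of n] by auto
    then have "D n u = DF (u, Z n (Suc l))"
      unfolding D_def using last_index(1)[of n] by (intro sum_indicator_partition[OF part]) auto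
    then show ?thesis using l by auto
  qed
  have D_0: "D n u = 0" if "\<not> (0 \<le> u \<and> u < x n (last_index n))" for n u
    unfolding D_def
  proof (rule sum.neutral, rule ballI)
    fix j assume "j \<in> {..<last_index n}"
    then have "0 \<le> x n j" "x n (Suc j) \<le> x n (last_index n)"
      using last_index(1)[of n] node_mem[of j n] by (auto intro!: partition_nth_mono[OF part])
    then show "indicator {x n j..<x n (Suc j)} u * DF (u, Z n (Suc j)) = 0"
      using that by (auto simp: indicator_def)
  qed
  have C0: "0 \<le> C"
  proof -
    have "stopped T 0 S \<in> tube T S 0 \<delta>" using C(1) t by (intro stopped_in_tube[OF S]) auto
    then have "\<bar>DF (0, stopped T 0 S)\<bar> \<le> C" using C(2) t by auto
    then show ?thesis by linarith
  qed
  have D_bound: "\<bar>D n u\<bar> \<le> C * indicator {0..t} u" if n: "n \<ge> n0" for n u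
  proof (cases "0 \<le> u \<and> u < x n (last_index n)")
    case True
    then obtain l where "l < last_index n" "u \<in> {x n l..<x n (Suc l)}" "D n u = DF (u, Z n (Suc l))"
      using D_eq by blast
    then have "\<bar>D n u\<bar> \<le> C" using bound[OF n] by (simp del: step_path.simps)
    then show ?thesis using True last_index(2)[of n] by (simp add: indicator_def)
  next
    case False
    then show ?thesis using D_0[OF False] C0 by (simp add: indicator_def)
  qed
  \<comment> \<open>Both sides evaluate the horizontal derivative at the same time u, so continuity
    in the path at fixed time suffices. At u = t the functions D n vanish while the limit need not;
    that point is a null set.\<close>
  have D_lim: "(\<lambda>n. D n u) \<longlonglongrightarrow> indicator {0..t} u * DF (u, stopped T u S)" if "u \<noteq> t" for u
  proof (cases "u \<in> {0..<t}")
    case True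
    show ?thesis
    proof (rule tendstoI)
      fix e :: real assume "e > 0"
      then obtain \<delta>' where \<delta>': "\<delta>' > 0" "\<forall>\<omega>\<in>tube T S u \<delta>'. \<bar>DF (u, \<omega>) - DF (u, stopped T u S)\<bar> < e"
        using tube_continuous[OF DF_C00 S, of u] True t by auto
      have "eventually (\<lambda>n. u < x n (last_index n)) sequentially"
        using True by (intro eventually_last_node_gt) simp
      then show "eventually (\<lambda>n. dist (D n u) (indicator {0..t} u * DF (u, stopped T u S)) < e) sequentially"
        using eventually_osc_le[OF \<delta>'(1)]
      proof eventually_elim
        case (elim n)
        obtain l where l: "l < last_index n" "u \<in> {x n l..<x n (Suc l)}" "D n u = DF (u, Z n (Suc l))"
          using D_eq[of u n] elim True by auto
        then have "Z n (Suc l) \<in> tube T S u \<delta>'"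
          using elim last_index(1)[of n] by (intro Z_Suc_in_tube) auto
        then show ?case using l(3) \<delta>'(2) True by (simp add: dist_real_def del: step_path.simps)
      qed
    qed
  next
    case False
    have "D n u = 0" for n using False last_index(2)[of n] by (intro D_0) auto
    moreover have "indicator {0..t} u = (0::real)" using False that by (auto simp: indicator_def)
    ultimately show ?thesis by simp
  qed
  \<comment> \<open>Shifted by n0, since the paths lie in the tube where the derivative is bounded
    only from there on.\<close>
  have "(\<lambda>n. integral\<^sup>L lborel (D (n + n0))) \<longlonglongrightarrow> (\<integral>u. indicator {0..t} u * DF (u, stopped T u S) \<partial>lborel)"
  proof (rule integral_dominated_convergence[where w = "\<lambda>u. C * indicator {0..t} u"])
    show "(\<lambda>u. indicator {0..t} u * DF (u, stopped T u S)) \<in> borel_measurable lborel"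
      using path_functional_measurable[OF DF_C00 S, of t] t by (simp add: mult.commute)
    show "D (n + n0) \<in> borel_measurable lborel" for n
      using D_int(1)[of "n + n0"] by auto
    show "AE u in lborel. (\<lambda>n. D (n + n0) u) \<longlonglongrightarrow> indicator {0..t} u * DF (u, stopped T u S)"
      using AE_lborel_singleton[of t] by eventually_elim (intro LIMSEQ_ignore_initial_segment D_lim)
    show "AE u in lborel. norm (D (n + n0) u) \<le> C * indicator {0..t} u" for n
      using D_bound[of "n + n0"] by simp
  qed (use t in simp)
  then have "(\<lambda>n. \<Sum>j<last_index (n + n0). F (x (n + n0) (Suc j), Z (n + n0) (Suc j)) - F (x (n + n0) j, Z (n + n0) (Suc j)))
      \<longlonglongrightarrow> (LINT s:{0..t}|lborel. DF (s, stopped T s S))"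
    using D_int(2) by (simp add: set_lebesgue_integral_def del: step_path.simps)
  then show ?thesis by (rule LIMSEQ_offset)
qed

lemma taylor_step:
  assumes j: "j < N n"
  shows "\<exists>\<theta>. \<bar>\<theta>\<bar> \<le> \<bar>\<Delta> n j\<bar> \<and> F (x n j, Z n (Suc j)) - F (x n j, Z n j) =
    (\<Sum>k=1..p-1. 1 / fact k * (G k (x n j, Z n j) * \<Delta> n j ^ k)) +
    1 / fact p * (G p (x n j, bumped T (x n j) \<theta> (Z n j)) * \<Delta> n j ^ p)"
proof -
  have j': "j \<le> N n" using j by simp
  have vd: "vertically_differentiable T (G k)" if "k < p" for k
    using F that by (simp add: C1p_b_def)
  obtain \<theta> where \<theta>: "\<bar>\<theta>\<bar> \<le> \<bar>\<Delta> n j\<bar>" "F (x n j, bumped T (x n j) (\<Delta> n j) (Z n j)) =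
    (\<Sum>k<p. G k (x n j, Z n j) / fact k * \<Delta> n j ^ k) + G p (x n j, bumped T (x n j) \<theta> (Z n j)) / fact p * \<Delta> n j ^ p"
    using vertical_taylor[OF vd G_C00 node_mem[OF j'] step_path_cadlag[OF part j'] stopped_step_path_nth[OF part j'],
        where h = "\<Delta> n j"] by blast
  have "{..<p} = insert 0 {1..p-1}" using p by auto
  then have "(\<Sum>k<p. G k (x n j, Z n j) / fact k * \<Delta> n j ^ k) =
      F (x n j, Z n j) + (\<Sum>k=1..p-1. 1 / fact k * (G k (x n j, Z n j) * \<Delta> n j ^ k))"
    by simp
  then show ?thesis
    using \<theta> step_path_Suc_eq_bumped[OF part j, of S] by (intro exI[of _ \<theta>]) (simp del: step_path.simps)
qed

definition \<theta> :: "nat \<Rightarrow> nat \<Rightarrow> real" where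
  "\<theta> n j = (SOME \<theta>. \<bar>\<theta>\<bar> \<le> \<bar>\<Delta> n j\<bar> \<and> F (x n j, Z n (Suc j)) - F (x n j, Z n j) =
    (\<Sum>k=1..p-1. 1 / fact k * (G k (x n j, Z n j) * \<Delta> n j ^ k)) +
    1 / fact p * (G p (x n j, bumped T (x n j) \<theta> (Z n j)) * \<Delta> n j ^ p))"

definition remainder :: "nat \<Rightarrow> nat \<Rightarrow> real" where
  "remainder n j = G p (x n j, bumped T (x n j) (\<theta> n j) (Z n j))"

lemma theta_le: "j < N n \<Longrightarrow> \<bar>\<theta> n j\<bar> \<le> \<bar>\<Delta> n j\<bar>"
  and taylor_remainder: "j < N n \<Longrightarrow> F (x n j, Z n (Suc j)) - F (x n j, Z n j) =
    (\<Sum>k=1..p-1. 1 / fact k * (G k (x n j, Z n j) * \<Delta> n j ^ k)) + 1 / fact p * (remainder n j * \<Delta> n j ^ p)"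
  using someI_ex[OF taylor_step[of j n]] unfolding remainder_def \<theta>_def by blast+

lemma Z_0: "Z n 0 = stopped T 0 S"
  by (auto simp: stopped_def fun_eq_iff)

text \<open>The telescoped identity solved for the orders 1 to p-1. Each term on the right has a
  limit, and this is how the limit on the left is obtained.\<close>

lemma main_sum_eq:
  "(\<Sum>j<last_index n. \<Sum>k=1..p-1. 1 / fact k * (G k (x n j, Z n j) * \<Delta> n j ^ k)) =
    F (x n (last_index n), Z n (last_index n)) - F (0, stopped T 0 S)
    - (\<Sum>j<last_index n. F (x n (Suc j), Z n (Suc j)) - F (x n j, Z n (Suc j)))
    - 1 / fact p * (\<Sum>j<last_index n. remainder n j * \<Delta> n j ^ p)"
proof -
  have "F (x n (last_index n), Z n (last_index n)) - F (0, stopped T 0 S) =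
      (\<Sum>j<last_index n. F (x n (Suc j), Z n (Suc j)) - F (x n j, Z n j))"
    using sum_lessThan_telescope[of "\<lambda>j. F (x n j, Z n j)" "last_index n"]
    by (simp only: Z_0 partition_nth_0[OF part])
  also have "\<dots> = (\<Sum>j<last_index n. (F (x n (Suc j), Z n (Suc j)) - F (x n j, Z n (Suc j))) +
      ((\<Sum>k=1..p-1. 1 / fact k * (G k (x n j, Z n j) * \<Delta> n j ^ k)) + 1 / fact p * (remainder n j * \<Delta> n j ^ p)))"
  proof (rule sum.cong)
    fix j assume "j \<in> {..<last_index n}"
    then have "j < N n" using last_index(1)[of n] by simp
    from taylor_remainder[OF this]
    show "F (x n (Suc j), Z n (Suc j)) - F (x n j, Z n j) = (F (x n (Suc j), Z n (Suc j)) - F (x n j, Z n (Suc j))) +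
      ((\<Sum>k=1..p-1. 1 / fact k * (G k (x n j, Z n j) * \<Delta> n j ^ k)) + 1 / fact p * (remainder n j * \<Delta> n j ^ p))"
      by linarith
  qed simp
  finally show ?thesis by (simp only: sum.distrib sum_distrib_left)
qed

text \<open>The threshold for n comes from \<open>osc\<close> alone, so it serves all nodes in the
  left neighbourhood of s at once, whatever intermediate jumps Taylor's formula has chosen.\<close>

lemma remainder_left:
  assumes "s \<in> {0<..t}" "e > 0"
  shows "\<exists>d>0. \<exists>n0. \<forall>n\<ge>n0. \<forall>j<N n. s - d < x n j \<and> x n j < s \<longrightarrow> \<bar>remainder n j - G p (s, stopped T s S)\<bar> < e"
proof -
  have "s \<in> {0..T}" using assms(1) t by auto
  then obtain \<delta> where \<delta>: "\<delta> > 0" "\<forall>v\<in>{0..<s}. s - \<delta> < v \<longrightarrow>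
      (\<forall>\<omega>\<in>tube T S v \<delta>. \<bar>G p (v, \<omega>) - G p (s, stopped T s S)\<bar> < e)"
    using tube_left_continuous[OF G_C00[OF order_refl] S _ assms(2)] by blast
  obtain n0 where n0: "\<And>n. n \<ge> n0 \<Longrightarrow> 2 * osc S (\<pi> n) \<le> \<delta>"
    using eventually_osc_le[OF \<delta>(1)] unfolding eventually_sequentially by blast
  have "\<bar>remainder n j - G p (s, stopped T s S)\<bar> < e"
    if n: "n \<ge> n0" and j: "j < N n" and xs: "s - \<delta> < x n j" "x n j < s" for n j
  proof -
    have "bumped T (x n j) (\<theta> n j) (Z n j) \<in> tube T S (x n j) \<delta>"
      using bumped_step_path_in_tube[OF part S T_pos j theta_le[OF j]] tube_mono[OF n0[OF n]] by blast
    moreover have "x n j \<in> {0..<s}" using xs node_mem[of j n] j by auto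
    ultimately show ?thesis using \<delta>(2) xs(1) unfolding remainder_def by blast
  qed
  then show ?thesis using \<delta>(1) by blast
qed

lemma remainder_bounded:
  "\<exists>C. \<exists>n0. \<forall>n\<ge>n0. \<forall>j<N n. x n j < t \<longrightarrow> \<bar>remainder n j\<bar> \<le> C"
proof -
  obtain C \<delta> where C: "\<delta> > 0" "\<forall>u\<in>{0..<t}. \<forall>\<omega>\<in>tube T S u \<delta>. \<bar>G p (u, \<omega>)\<bar> \<le> C"
    using tube_bounded[OF G_C00[OF order_refl] G_bounded[OF order_refl] S t] by blast
  obtain n0 where n0: "\<And>n. n \<ge> n0 \<Longrightarrow> 2 * osc S (\<pi> n) \<le> \<delta>"
    using eventually_osc_le[OF C(1)] unfolding eventually_sequentially by blast
  have "\<bar>remainder n j\<bar> \<le> C" if n: "n \<ge> n0" and j: "j < N n" and xt: "x n j < t" for n j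
  proof -
    have "bumped T (x n j) (\<theta> n j) (Z n j) \<in> tube T S (x n j) \<delta>"
      using bumped_step_path_in_tube[OF part S T_pos j theta_le[OF j]] tube_mono[OF n0[OF n]] by blast
    moreover have "x n j \<in> {0..<t}" using xt node_mem[of j n] j by auto
    ultimately show ?thesis using C(2) unfolding remainder_def by blast
  qed
  then show ?thesis by blast
qed

lemma increment_le_osc': "j < N n \<Longrightarrow> \<bar>\<Delta> n j\<bar> \<le> osc S (\<pi> n)"
  using node_less[of j "Suc j" n] by (intro increment_le_osc) auto

lemma osc_power_tendsto: "0 < k \<Longrightarrow> (\<lambda>n. C * osc S (\<pi> n) ^ k) \<longlonglongrightarrow> 0"
  using tendsto_mult_right_zero[OF tendsto_null_power[OF osc_lim]] by blast

text \<open>As p is even, the p-th powers of the increments are the weights of the discrete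
  variation measure, so the convergence theorem for left-continuous integrands applies. What remains
  is the cell containing t and the point t itself, which is null for \<nu>.\<close>

lemma remainder_sum_tendsto:
  assumes lim: "is_limit_variation T p \<pi> S \<mu>" and even: "even p"
  defines "\<nu> \<equiv> distr \<mu> borel (\<lambda>u. u)"
  shows "(\<lambda>n. \<Sum>j<last_index n. remainder n j * \<Delta> n j ^ p) \<longlonglongrightarrow> (LINT s:{0..t}|\<nu>. G p (s, stopped T s S))"
proof -
  define f where "f s = G p (s, stopped T s S)" for s
  interpret V: weighted_nodes_limit \<nu> N x "\<lambda>n j. \<bar>\<Delta> n j\<bar> ^ p"
    unfolding \<nu>_def by (rule weighted_nodes_limit_variation[OF lim part])
  obtain C1 where C1: "\<And>u. u \<in> {0..t} \<Longrightarrow> \<bar>f u\<bar> \<le> C1"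
    using path_functional_bounded[OF G_C00[OF order_refl] G_bounded[OF order_refl] S t] unfolding f_def by blast
  obtain C2 n2 where C2: "\<And>n j. n \<ge> n2 \<Longrightarrow> j < N n \<Longrightarrow> x n j < t \<Longrightarrow> \<bar>remainder n j\<bar> \<le> C2"
    using remainder_bounded by blast
  have f_meas: "(\<lambda>u. f u * indicator {0..t} u) \<in> borel_measurable borel"
    "(\<lambda>u. f u * indicator {0..<t} u) \<in> borel_measurable borel"
  proof -
    show m: "(\<lambda>u. f u * indicator {0..t} u) \<in> borel_measurable borel"
      unfolding f_def using t by (intro path_functional_measurable[OF G_C00[OF order_refl] S]) auto
    have "(\<lambda>u. (f u * indicator {0..t} u) * indicator {..<t} u) \<in> borel_measurable borel"
      by (rule borel_measurable_times[OF m]) auto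
    moreover have "(f u * indicator {0..t} u) * indicator {..<t} u = f u * indicator {0..<t} u" for u
      by (auto simp: indicator_def)
    ultimately show "(\<lambda>u. f u * indicator {0..<t} u) \<in> borel_measurable borel" by simp
  qed
  have "(\<lambda>n. \<Sum>j<N n. \<bar>\<Delta> n j\<bar> ^ p * (remainder n j * indicator {0..<t} (x n j)))
      \<longlonglongrightarrow> (\<integral>u. f u * indicator {0..<t} u \<partial>\<nu>)"
  proof (rule V.weighted_sum_tendsto)
    show "0 \<le> x n j" if "j < N n" for n j using node_mem[of j n] that by simp
    show "\<exists>d>0. \<forall>u. 0 \<le> u \<and> s - d < u \<and> u < s \<longrightarrow> \<bar>f u - f s\<bar> < e" if st: "s \<in> {0<..t}" and e: "e > 0" for s e
    proof -
      have s: "s \<in> {0..T}" using st t by auto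
      then obtain \<delta> where \<delta>: "\<delta> > 0" "\<forall>v\<in>{0..<s}. s - \<delta> < v \<longrightarrow>
          (\<forall>\<omega>\<in>tube T S v \<delta>. \<bar>G p (v, \<omega>) - G p (s, stopped T s S)\<bar> < e)"
        using tube_left_continuous[OF G_C00[OF order_refl] S _ e] by blast
      have "stopped T u S \<in> tube T S u \<delta>" if "0 \<le> u" "u < s" for u
        using that s \<delta>(1) by (intro stopped_in_tube[OF S]) auto
      then show ?thesis using \<delta> unfolding f_def by (intro exI[of _ \<delta>]) auto
    qed
    show "\<exists>d>0. \<exists>n0. \<forall>n\<ge>n0. \<forall>j<N n. s - d < x n j \<and> x n j < s \<longrightarrow> \<bar>remainder n j - f s\<bar> < e"
      if "s \<in> {0<..t}" "e > 0" for s e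
      unfolding f_def by (rule remainder_left[OF that])
    show "\<bar>f u\<bar> \<le> max C1 C2" if "u \<in> {0..<t}" for u using C1[of u] that by simp
    show "\<exists>n0. \<forall>n\<ge>n0. \<forall>j<N n. x n j < t \<longrightarrow> \<bar>remainder n j\<bar> \<le> max C1 C2"
      using C2 by (intro exI[of _ n2]) (auto intro: max.coboundedI2)
    show "(\<lambda>u. f u * indicator {0..<t} u) \<in> borel_measurable borel" by (rule f_meas(2))
  qed
  moreover have "(\<Sum>j<N n. \<bar>\<Delta> n j\<bar> ^ p * (remainder n j * indicator {0..<t} (x n j))) =
      (\<Sum>j<last_index n. remainder n j * \<Delta> n j ^ p) + remainder n (last_index n) * \<Delta> n (last_index n) ^ p" for n
  proof -
    have "(\<Sum>j<N n. \<bar>\<Delta> n j\<bar> ^ p * (remainder n j * indicator {0..<t} (x n j))) =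
        (\<Sum>j\<le>last_index n. remainder n j * \<Delta> n j ^ p)"
    proof (rule sum.mono_neutral_cong_right)
      show "{..last_index n} \<subseteq> {..<N n}" using last_index(1)[of n] by auto
      show "\<forall>j\<in>{..<N n} - {..last_index n}. \<bar>\<Delta> n j\<bar> ^ p * (remainder n j * indicator {0..<t} (x n j)) = 0"
        using less_t_iff[of _ n] by (auto simp: indicator_def)
      fix j assume "j \<in> {..last_index n}"
      then have "j < N n" "x n j < t" using last_index(1)[of n] less_t_iff[of j n] by auto
      then show "\<bar>\<Delta> n j\<bar> ^ p * (remainder n j * indicator {0..<t} (x n j)) = remainder n j * \<Delta> n j ^ p"
        using node_mem[of j n] even by (simp add: power_even_abs)
    qed simp
    then show ?thesis by (simp flip: lessThan_Suc_atMost)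
  qed
  \<comment> \<open>The node of this cell lies below t and is counted by the measure on [0, t), but
    the telescope stops there. A single term is of the order of a power of
    \<open>osc\<close>.\<close>
  moreover have "(\<lambda>n. remainder n (last_index n) * \<Delta> n (last_index n) ^ p) \<longlonglongrightarrow> 0"
  proof (rule Lim_null_comparison)
    show "eventually (\<lambda>n. norm (remainder n (last_index n) * \<Delta> n (last_index n) ^ p) \<le> C2 * osc S (\<pi> n) ^ p) sequentially"
      using eventually_ge_at_top[of n2]
    proof eventually_elim
      case (elim n)
      have "\<bar>remainder n (last_index n)\<bar> \<le> C2" using C2 elim last_index[of n] by blast
      then show ?case
        using increment_le_osc'[OF last_index(1), of n]
        by (auto simp: abs_mult power_abs intro!: mult_mono power_mono)
    qed
    show "(\<lambda>n. C2 * osc S (\<pi> n) ^ p) \<longlonglongrightarrow> 0" using p by (intro osc_power_tendsto) simp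
  qed
  ultimately have "(\<lambda>n. \<Sum>j<last_index n. remainder n j * \<Delta> n j ^ p) \<longlonglongrightarrow> (\<integral>u. f u * indicator {0..<t} u \<partial>\<nu>)"
    using Lim_transform2 tendsto_diff[of "\<lambda>n. (\<Sum>j<last_index n. remainder n j * \<Delta> n j ^ p) + remainder n (last_index n) * \<Delta> n (last_index n) ^ p"
      _ sequentially "\<lambda>n. remainder n (last_index n) * \<Delta> n (last_index n) ^ p" 0] by simp
  moreover have "(\<integral>u. f u * indicator {0..<t} u \<partial>\<nu>) = (\<integral>u. indicator {0..t} u *\<^sub>R f u \<partial>\<nu>)"
  proof (rule integral_cong_AE)
    show "(\<lambda>u. indicator {0..t} u *\<^sub>R f u) \<in> borel_measurable \<nu>"
      "(\<lambda>u. f u * indicator {0..<t} u) \<in> borel_measurable \<nu>"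
      using f_meas by (simp_all add: mult.commute measurable_cong_sets[OF V.M_is_borel refl])
    have "AE u in \<nu>. u \<noteq> t"
      by (rule AE_I[of _ _ "{t}"]) (auto simp: V.emeasure_eq_measure V.atomless)
    then show "AE u in \<nu>. f u * indicator {0..<t} u = indicator {0..t} u *\<^sub>R f u"
      by eventually_elim (auto simp: indicator_def)
  qed
  ultimately show ?thesis by (simp add: set_lebesgue_integral_def f_def)
qed

text \<open>The sums in the definition of the integral differ from the telescoped ones in at most
  two cells: the first, where the path stopped at 0- already has the value S(t_1), and the one
  containing t, where the increment is cut at t. As k \<ge> 1, each discrepancy carries at least one
  power of \<open>osc\<close>.\<close>

lemma boundary_terms_tendsto:
  assumes k: "k \<in> {1..p-1}"
  shows "(\<lambda>n. (\<Sum>j<N n. G k (x n j, Z n (max 1 j)) * (S (min (x n (Suc j)) t) - S (min (x n j) t)) ^ k)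
      - (\<Sum>j<last_index n. G k (x n j, Z n j) * \<Delta> n j ^ k)) \<longlonglongrightarrow> 0"
proof -
  define c where "c n j = G k (x n j, Z n (max 1 j)) * (S (min (x n (Suc j)) t) - S (min (x n j) t)) ^ k" for n j
  define b where "b n j = G k (x n j, Z n j) * \<Delta> n j ^ k" for n j
  have kp: "k \<le> p" "0 < k" using k by auto
  obtain C \<delta> where C: "\<delta> > 0" "\<forall>u\<in>{0..<t}. \<forall>\<omega>\<in>tube T S u \<delta>. \<bar>G k (u, \<omega>)\<bar> \<le> C"
    using tube_bounded[OF G_C00[OF kp(1)] G_bounded[OF kp(1)] S t] by blast
  have diff: "(\<Sum>j<N n. c n j) - (\<Sum>j<last_index n. b n j) =
      c n (last_index n) + (if last_index n = 0 then 0 else c n 0 - b n 0)" for n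
  proof -
    have "(\<Sum>j<N n. c n j) = (\<Sum>j\<le>last_index n. c n j)"
    proof (rule sum.mono_neutral_right)
      show "{..last_index n} \<subseteq> {..<N n}" using last_index(1)[of n] by auto
      show "\<forall>j\<in>{..<N n} - {..last_index n}. c n j = 0"
      proof
        fix j assume "j \<in> {..<N n} - {..last_index n}"
        then have "t \<le> x n j" "x n j < x n (Suc j)"
          using less_t_iff[of j n] node_less[of j "Suc j" n] by auto
        then show "c n j = 0" using kp by (simp add: c_def min_def)
      qed
    qed simp
    also have "\<dots> = c n (last_index n) + (\<Sum>j<last_index n. c n j)"
      by (simp flip: lessThan_Suc_atMost)
    finally have "(\<Sum>j<N n. c n j) - (\<Sum>j<last_index n. b n j) =
        c n (last_index n) + (\<Sum>j<last_index n. c n j - b n j)"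
      by (simp add: sum_subtractf)
    also have "(\<Sum>j<last_index n. c n j - b n j) = (\<Sum>j<last_index n. if j = 0 then c n 0 - b n 0 else 0)"
    proof (rule sum.cong)
      fix j assume "j \<in> {..<last_index n}"
      then have "x n (Suc j) < t" "x n j < x n (Suc j)"
        using last_index(1)[of n] less_t_iff[of "Suc j" n] node_less[of j "Suc j" n] by auto
      then have "min (x n (Suc j)) t = x n (Suc j)" "min (x n j) t = x n j" by auto
      then show "c n j - b n j = (if j = 0 then c n 0 - b n 0 else 0)"
        by (cases "j = 0") (auto simp: c_def b_def max_def simp del: step_path.simps)
    qed simp
    also have "\<dots> = (if last_index n = 0 then 0 else c n 0 - b n 0)" by simp
    finally show ?thesis .
  qed
  have "(\<lambda>n. (\<Sum>j<N n. c n j) - (\<Sum>j<last_index n. b n j)) \<longlonglongrightarrow> 0"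
  proof (rule Lim_null_comparison)
    show "eventually (\<lambda>n. norm ((\<Sum>j<N n. c n j) - (\<Sum>j<last_index n. b n j)) \<le> (3 * C) * osc S (\<pi> n) ^ k) sequentially"
      using eventually_osc_le[OF C(1)]
    proof eventually_elim
      case (elim n)
      have c: "\<bar>c n j\<bar> \<le> C * osc S (\<pi> n) ^ k" and b: "\<bar>b n j\<bar> \<le> C * osc S (\<pi> n) ^ k"
        if j: "j \<le> last_index n" for j
      proof -
        have jN: "j < N n" and xt: "x n j < t" using j last_index(1)[of n] less_t_iff[of j n] by auto
        have x: "x n j \<in> {0..<t}" "x n j < x n (Suc j)" using xt node_mem[of j n] node_less[of j "Suc j" n] jN by auto
        have Zj: "Z n j \<in> tube T S (x n j) \<delta>" using jN elim by (intro Z_in_tube) auto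
        have "Z n (max 1 j) \<in> tube T S (x n j) \<delta>"
        proof (cases "j = 0")
          case True
          then show ?thesis using Z_Suc_in_tube[of 0 n "x n 0" \<delta>] jN x elim by (simp del: step_path.simps)
        next
          case False
          then show ?thesis using Zj by (simp add: max_def)
        qed
        then have "\<bar>G k (x n j, Z n (max 1 j))\<bar> \<le> C" using C(2) x by blast
        moreover have "\<bar>S (min (x n (Suc j)) t) - S (min (x n j) t)\<bar> \<le> osc S (\<pi> n)"
          using x by (intro increment_le_osc[OF jN]) auto
        ultimately show "\<bar>c n j\<bar> \<le> C * osc S (\<pi> n) ^ k"
          unfolding c_def abs_mult power_abs by (intro mult_mono power_mono) auto
        have "\<bar>G k (x n j, Z n j)\<bar> \<le> C" using C(2) x Zj by blast
        then show "\<bar>b n j\<bar> \<le> C * osc S (\<pi> n) ^ k"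
          unfolding b_def abs_mult power_abs using increment_le_osc'[OF jN] by (intro mult_mono power_mono) auto
      qed
      \<comment> \<open>Three terms: the cut one at t, and the two versions of the first
        cell.\<close>
      have "\<bar>c n (last_index n) + (if last_index n = 0 then 0 else c n 0 - b n 0)\<bar> \<le> 3 * (C * osc S (\<pi> n) ^ k)"
        using c[of "last_index n"] c[of 0] b[of 0] by (auto split: if_splits)
      then show ?case by (simp add: diff mult.assoc)
    qed
    show "(\<lambda>n. (3 * C) * osc S (\<pi> n) ^ k) \<longlonglongrightarrow> 0" using kp by (intro osc_power_tendsto)
  qed
  then show ?thesis by (simp add: c_def b_def)
qed

lemma integral_sum_minus_main_sum_tendsto:
  "(\<lambda>n. integral_sum T p F S (\<pi> n) t -
    (\<Sum>j<last_index n. \<Sum>k=1..p-1. 1 / fact k * (G k (x n j, Z n j) * \<Delta> n j ^ k))) \<longlonglongrightarrow> 0"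
proof -
  have eq: "integral_sum T p F S (\<pi> n) t -
      (\<Sum>j<last_index n. \<Sum>k=1..p-1. 1 / fact k * (G k (x n j, Z n j) * \<Delta> n j ^ k)) =
    (\<Sum>k=1..p-1. 1 / fact k * ((\<Sum>j<N n. G k (x n j, Z n (max 1 j)) * (S (min (x n (Suc j)) t) - S (min (x n j) t)) ^ k)
      - (\<Sum>j<last_index n. G k (x n j, Z n j) * \<Delta> n j ^ k)))" for n
  proof -
    have "integral_sum T p F S (\<pi> n) t =
        (\<Sum>j<N n. \<Sum>k=1..p-1. 1 / fact k * (G k (x n j, Z n (max 1 j)) * (S (min (x n (Suc j)) t) - S (min (x n j) t)) ^ k))"
      unfolding integral_sum_def
      by (intro sum.cong refl) (simp add: stopped_left_pc_approx[OF part] mult.assoc del: step_path.simps)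
    also have "\<dots> = (\<Sum>k=1..p-1. 1 / fact k * (\<Sum>j<N n. G k (x n j, Z n (max 1 j)) * (S (min (x n (Suc j)) t) - S (min (x n j) t)) ^ k))"
      by (subst sum.swap) (simp only: sum_distrib_left)
    moreover have "(\<Sum>j<last_index n. \<Sum>k=1..p-1. 1 / fact k * (G k (x n j, Z n j) * \<Delta> n j ^ k)) =
        (\<Sum>k=1..p-1. 1 / fact k * (\<Sum>j<last_index n. G k (x n j, Z n j) * \<Delta> n j ^ k))"
      by (subst sum.swap) (simp only: sum_distrib_left)
    ultimately show ?thesis by (simp only: right_diff_distrib sum_subtractf)
  qed
  have "(\<lambda>n. \<Sum>k=1..p-1. 1 / fact k * ((\<Sum>j<N n. G k (x n j, Z n (max 1 j)) * (S (min (x n (Suc j)) t) - S (min (x n j) t)) ^ k)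
      - (\<Sum>j<last_index n. G k (x n j, Z n j) * \<Delta> n j ^ k))) \<longlonglongrightarrow> (\<Sum>k=1..p-1. 1 / fact k * 0)"
    by (intro tendsto_sum tendsto_mult tendsto_const boundary_terms_tendsto)
  then show ?thesis by (simp only: eq mult_zero_right sum.neutral_const)
qed

lemma integral_sum_tendsto:
  assumes "is_limit_variation T p \<pi> S \<mu>" "even p"
  shows "(\<lambda>n. integral_sum T p F S (\<pi> n) t) \<longlonglongrightarrow>
    F (t, stopped T t S) - F (0, stopped T 0 S) - (LINT s:{0..t}|lborel. DF (s, stopped T s S))
    - 1 / fact p * (LINT s:{0..t}|distr \<mu> borel (\<lambda>u. u). G p (s, stopped T s S))" (is "_ \<longlonglongrightarrow> ?L")
proof -
  have "(\<lambda>n. \<Sum>j<last_index n. \<Sum>k=1..p-1. 1 / fact k * (G k (x n j, Z n j) * \<Delta> n j ^ k)) \<longlonglongrightarrow> ?L"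
    unfolding main_sum_eq
    by (intro tendsto_diff tendsto_mult tendsto_const last_value_tendsto horizontal_sum_tendsto
        remainder_sum_tendsto assms)
  from tendsto_add[OF integral_sum_minus_main_sum_tendsto this] show ?thesis by simp
qed

end

theorem theorem1p10:
  fixes T :: real and p :: nat and F :: functional
    and \<pi> :: "nat \<Rightarrow> real list" and S :: "real \<Rightarrow> real" and t :: real
  assumes "T > 0"
    and "p \<ge> 2" and "even p"
    and "F \<in> C1p_b T p"
    and "\<And>n. is_partition T (\<pi> n)"
    and "(\<lambda>n. mesh (\<pi> n)) \<longlonglongrightarrow> 0"
    and "S \<in> V T p \<pi>"
    and "t \<in> {0..T}"
  shows "convergent (\<lambda>n. integral_sum T p F S (\<pi> n) t)
      \<and> set_integrable lborel {0..t} (\<lambda>s. hderiv T F (s, stopped T s S))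
      \<and> set_integrable (interval_measure (pvariation T p \<pi> S)) {0..t}
           (\<lambda>s. (vderiv T ^^ p) F (s, stopped T s S))
      \<and> F (t, stopped T t S) = F (0, stopped T 0 S)
           + (LINT s:{0..t}|lborel. hderiv T F (s, stopped T s S))
           + pathwise_integral T p \<pi> F S t
           + 1 / fact p * (LINT s:{0..t}|interval_measure (pvariation T p \<pi> S).
                             (vderiv T ^^ p) F (s, stopped T s S))"
proof -
  have S: "continuous_on {0..T} S" and osc: "(\<lambda>n. osc S (\<pi> n)) \<longlonglongrightarrow> 0"
    using assms(7) by (auto simp: V_def)
  obtain \<mu> where \<mu>: "is_limit_variation T p \<pi> S \<mu>" using assms(7) by (auto simp: V_def)
  define \<nu> where "\<nu> = distr \<mu> borel (\<lambda>u. u)"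
  have im: "interval_measure (pvariation T p \<pi> S) = \<nu>"
    unfolding \<nu>_def by (rule interval_measure_pvariation[OF \<mu> assms(5)])
  interpret V: weighted_nodes_limit \<nu> "\<lambda>n. num_intervals (\<pi> n)" "\<lambda>n j. \<pi> n ! j"
      "\<lambda>n j. \<bar>S (\<pi> n ! Suc j) - S (\<pi> n ! j)\<bar> ^ p"
    unfolding \<nu>_def by (rule weighted_nodes_limit_variation[OF \<mu> assms(5)])
  show ?thesis
  proof (cases "t = 0")
    case True
    \<comment> \<open>At t = 0 all increments vanish, and they occur only with exponents k \<ge> 1;
      both integrals run over the null set {0}.\<close>
    have "min (\<pi> n ! j) t = 0" if "j \<le> num_intervals (\<pi> n)" for n j
      using partition_nth_mem[OF assms(5) that] True by simp
    then have "integral_sum T p F S (\<pi> n) t = 0" for n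
      unfolding integral_sum_def by (intro sum.neutral ballI) auto
    moreover have "emeasure \<nu> {0} = 0" by (simp add: V.emeasure_eq_measure V.atomless)
    moreover have null: "set_integrable M {0..0} f" "set_lebesgue_integral M {0..0} f = 0"
      if "sets M = sets borel" "emeasure M {0} = 0" for M and f :: "real \<Rightarrow> real"
    proof -
      \<comment> \<open>On one point any function is constant, so measurability of f need not be
        known.\<close>
      have eq: "(\<lambda>u. indicator {0..0} u *\<^sub>R f u) = (\<lambda>u. indicator {0} u * f 0)"
        by (auto simp: indicator_def)
      show "set_integrable M {0..0} f" "set_lebesgue_integral M {0..0} f = 0"
        unfolding set_integrable_def set_lebesgue_integral_def eq
        using that by (auto simp: measure_def intro!: integrable_mult_left)
    qed
    ultimately show ?thesis
      using True by (simp add: im pathwise_integral_def convergent_const null V.M_is_borel)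
  next
    case False
    then have t: "t \<in> {0<..T}" using assms(8) by auto
    interpret functional_along_partitions T p F \<pi> S t
      by unfold_locales (use assms S osc t in auto)
    note lim = integral_sum_tendsto[OF \<mu> assms(3)]
    have "set_integrable lborel {0..t} (\<lambda>s. hderiv T F (s, stopped T s S))"
      using t by (intro path_functional_set_integrable[OF DF_C00 DF_bounded S t]) auto
    moreover have "set_integrable \<nu> {0..t} (\<lambda>s. (vderiv T ^^ p) F (s, stopped T s S))"
      by (intro path_functional_set_integrable[OF G_C00[OF order_refl] G_bounded[OF order_refl] S t])
        (auto simp: V.M_is_borel less_top[symmetric])
    ultimately show ?thesis
      using lim limI[OF lim] by (auto simp: im pathwise_integral_def convergent_def \<nu>_def)
  qed
qed

end
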